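(* Let $d=2^t$ be a power of two. Let $m$ be a positive integer, and let $X = \{x_1, \dots, x_m\} \subset \mathbb{R}^{2d-2}$ be a set of $m$ points. For each $j\in[2d]$ let $A_1^{(j)}, \dots, A_m^{(j)} \subset S^d \times S^{d-1}$ be closed sets such that $A_i^{(j)} \cap g_1\cdot A_i^{(k)} = \emptyset$ and $A_i^{(j)} \cap g_2 \cdot A_i^{(k)} = \emptyset$ for all $i \in [m]$ and all $j \neq k \in [2d]$. Further assume that $\bigcup_i G\cdot A_i^{(j)} = S^d \times S^{d-1}$ for all $j\in [2d]$. Then there are disjoint subsets $S, T \subset [m]$, functions $\alpha\colon S \to \{g_1, g_2\}$ and $\beta \colon T\to \{1, g_1g_2\}$, and an injective function $\pi\colon S\cup T \to [2d]$ such that \[\operatorname{conv}\{x_i \mid i \in S\} \cap \operatorname{conv}\{x_i \mid i \in T\} \neq \emptyset \quad\text{and}\quad \bigcap_{i \in S} (\alpha(i)\cdot A_i^{(\pi(i))}) \cap \bigcap_{i \in T} (\beta(i)\cdot A_i^{(\pi(i))}) \neq \emptyset.\]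
   Context: $(\mathbb{Z}/2)^2$ with generators $g_1,g_2$ (identity $1$) acts on $S^d\times S^{d-1}$ by $g_1\cdot(x,y)=(-x,y)$ and $g_2\cdot(x,y)=(x,-y)$. For $A\subset S^d\times S^{d-1}$, $g\cdot A=\{g\cdot p \mid p\in A\}$ and $G\cdot A = A\cup g_1\cdot A\cup g_2\cdot A\cup g_1g_2\cdot A$. *)

theory Defs
  imports "HOL-Analysis.Analysis"
begin

text \<open>
  The group \<open>(\<int>/2)\<^sup>2\<close> is represented by the four transformations \<open>id\<close>, \<open>g1\<close>, \<open>g2\<close>, \<open>g1 \<circ> g2\<close>
  through which it acts (the action is faithful), so that \<open>g \<cdot> A\<close> is the image \<open>g ` A\<close>.
\<close>

definition g1 :: "'a::real_vector \<times> 'b::real_vector \<Rightarrow> 'a \<times> 'b" where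
  "g1 p = (- fst p, snd p)"

definition g2 :: "'a::real_vector \<times> 'b::real_vector \<Rightarrow> 'a \<times> 'b" where
  "g2 p = (fst p, - snd p)"

definition G_orbit :: "('a::real_vector \<times> 'b::real_vector) set \<Rightarrow> ('a \<times> 'b) set" where
  "G_orbit A = A \<union> g1 ` A \<union> g2 ` A \<union> (g1 \<circ> g2) ` A"

text \<open>
  The product of the unit spheres of \<open>'a\<close> and \<open>'b\<close>; it is \<open>S\<^sup>d \<times> S\<^bsup>d-1\<^esup>\<close> when
  \<open>DIM('a) = d + 1\<close> and \<open>DIM('b) = d\<close>.
\<close>

definition sphere_prod :: "('a::euclidean_space \<times> 'b::euclidean_space) set" where
  "sphere_prod = sphere 0 1 \<times> sphere 0 1"

end

theory Submission
  imports Defs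
begin

text \<open>
  Put \<open>n = 2 d - 1\<close>. Triangulate \<open>S\<^sup>d \<times> S\<^bsup>d-1\<^esup>\<close> finely and equivariantly, such that each simplex has one
  vertex of each colour \<open>1, \<dots>, 2 d\<close>. A vertex of colour \<open>j\<close> lying in \<open>A\<^sub>i\<^sup>(\<^sup>j\<^sup>) \<union> g\<^sub>1 g\<^sub>2 \<cdot> A\<^sub>i\<^sup>(\<^sup>j\<^sup>)\<close> gets
  the label \<open>(x\<^sub>i, 1)\<close>, one lying in \<open>g\<^sub>1 \<cdot> A\<^sub>i\<^sup>(\<^sup>j\<^sup>) \<union> g\<^sub>2 \<cdot> A\<^sub>i\<^sup>(\<^sup>j\<^sup>)\<close> the label \<open>- (x\<^sub>i, 1)\<close>. This can be done
  such that both \<open>g\<^sub>1\<close> and \<open>g\<^sub>2\<close> negate labels. If the labels of some simplex have the origin in their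
  convex hull, then a limit over finer and finer triangulations yields the theorem.

  For labels in general position in an \<open>n\<close>-dimensional space, the number of simplices with the origin in
  the hull of their labels does not change modulo 8 when the labels of one orbit are moved: in the star of
  one vertex it changes by an even number, and an orbit has four vertices. So it is enough to find
  one odd labelling in general position for which the number is not divisible by 8. For the staircase
  triangulation of the product of two cross-polytope boundaries, labelling by the rank with a sign gives
  4 times the number of lattice paths from \<open>(0, 0)\<close> to \<open>(d, d - 1)\<close>, and \<open>(2 d - 1) choose d\<close> is odd
  since \<open>d\<close> is a power of two. Giving each face the label of its lowest vertex, one sees that
  barycentric subdivision preserves the number.
\<close>

section \<open>Families of vectors with the origin in their convex hull\<close>

abbreviation balanced :: "('v \<Rightarrow> 'w::real_vector) \<Rightarrow> 'v set \<Rightarrow> bool" where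
  "balanced z S \<equiv> 0 \<in> convex hull (z ` S)"

lemma balanced_mono: "balanced z S \<Longrightarrow> S \<subseteq> T \<Longrightarrow> balanced z T"
  using hull_mono[of "z ` S" "z ` T"] by blast

lemma balanced_uminus: "balanced (\<lambda>v. - z v) S \<longleftrightarrow> balanced z S"
proof -
  have "convex hull ((\<lambda>v. - z v) ` S) = uminus ` (convex hull (z ` S))"
    using convex_hull_scaling[of "-1" "z ` S"] by (simp add: image_image)
  then show ?thesis by force
qed

lemma not_balanced_perturbation:
  fixes z :: "'v \<Rightarrow> 'w::euclidean_space"
  assumes "finite S" "\<not> balanced z S"
  obtains \<epsilon> where "\<epsilon> > 0" "\<And>y. (\<And>v. v \<in> S \<Longrightarrow> dist (y v) (z v) < \<epsilon>) \<Longrightarrow> \<not> balanced y S"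
proof -
  have "closed (convex hull (z ` S))"
    using assms(1) by (intro compact_imp_closed finite_imp_compact_convex_hull) simp
  then obtain \<epsilon> where "\<epsilon> > 0" and far: "\<And>q. q \<in> convex hull (z ` S) \<Longrightarrow> \<epsilon> \<le> norm q"
    using separate_point_closed[of "convex hull (z ` S)" 0] assms(2) by auto
  have "\<not> balanced y S" if close: "\<And>v. v \<in> S \<Longrightarrow> dist (y v) (z v) < \<epsilon>" for y
  proof
    let ?N = "\<Union>q\<in>convex hull (z ` S). \<Union>b\<in>ball 0 \<epsilon>. {q + b}"
    assume "balanced y S"
    moreover have "y ` S \<subseteq> ?N"
    proof (rule image_subsetI)
      fix v assume "v \<in> S"
      then have "z v \<in> convex hull (z ` S)" "y v - z v \<in> ball 0 \<epsilon>" "y v = z v + (y v - z v)"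
        using close by (auto simp: hull_inc dist_norm norm_minus_commute)
      then show "y v \<in> ?N" by blast
    qed
    then have "convex hull (y ` S) \<subseteq> ?N"
      by (intro hull_minimal convex_sums convex_convex_hull convex_ball)
    ultimately obtain q b where "q \<in> convex hull (z ` S)" "norm b < \<epsilon>" "0 = q + b" by force
    then show False using far[of q] by (simp add: eq_neg_iff_add_eq_0[symmetric])
  qed
  with \<open>\<epsilon> > 0\<close> show thesis by (rule that)
qed

lemma zero_in_convex_hull_insert_imp:
  assumes "0 \<in> convex hull (insert a X)" "a \<notin> span X"
  shows "0 \<in> convex hull X"
proof -
  have "X \<noteq> {}" using assms by auto
  then obtain u v b where combination: "u + v = 1" "b \<in> convex hull X" "0 = u *\<^sub>R a + v *\<^sub>R b"
    using assms(1) by (auto simp: convex_hull_insert)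
  have "u = 0"
  proof (rule ccontr)
    assume "u \<noteq> 0"
    have "u *\<^sub>R a = (- v) *\<^sub>R b" using combination(3) by (simp add: eq_neg_iff_add_eq_0)
    then have "u *\<^sub>R a \<in> span X"
      using combination(2) convex_hull_subset_span span_scale by (metis subsetD)
    then have "(1 / u) *\<^sub>R u *\<^sub>R a \<in> span X" by (rule span_scale)
    then show False using \<open>u \<noteq> 0\<close> assms(2) by simp
  qed
  then show ?thesis using combination by simp
qed

definition linear_relation :: "('v \<Rightarrow> 'w::real_vector) \<Rightarrow> 'v set \<Rightarrow> ('v \<Rightarrow> real) \<Rightarrow> bool" where
  "linear_relation z U c \<longleftrightarrow> (\<Sum>v\<in>U. c v *\<^sub>R z v) = 0"

definition nonneg_relation :: "('v \<Rightarrow> 'w::real_vector) \<Rightarrow> 'v set \<Rightarrow> ('v \<Rightarrow> real) \<Rightarrow> bool" where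
  "nonneg_relation z U c \<longleftrightarrow> linear_relation z U c \<and> (\<forall>v\<in>U. 0 \<le> c v) \<and> (\<exists>v\<in>U. c v \<noteq> 0)"

lemma linear_relation_add_scaled:
  assumes "linear_relation z U p" "linear_relation z U q"
  shows "linear_relation z U (\<lambda>v. p v + r * q v)"
  using assms unfolding linear_relation_def
  by (simp add: scaleR_add_left sum.distrib flip: scaleR_scaleR scaleR_sum_right)

lemma linear_relation_extend:
  assumes "finite U" "X \<subseteq> U"
  shows "linear_relation z U (\<lambda>v. if v \<in> X then c v else 0) \<longleftrightarrow> linear_relation z X c"
proof -
  have "(\<Sum>v\<in>U. (if v \<in> X then c v else 0) *\<^sub>R z v) = (\<Sum>v\<in>X. c v *\<^sub>R z v)"
    using assms by (intro sum.mono_neutral_cong_right) auto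
  then show ?thesis by (simp add: linear_relation_def)
qed

lemma linear_relation_restrict:
  assumes "finite U" "X \<subseteq> U" "linear_relation z U c" "\<And>v. v \<in> U - X \<Longrightarrow> c v = 0"
  shows "linear_relation z X c"
proof -
  have "(\<Sum>v\<in>X. c v *\<^sub>R z v) = (\<Sum>v\<in>U. c v *\<^sub>R z v)"
    using assms by (intro sum.mono_neutral_left) auto
  then show ?thesis using assms(3) by (simp add: linear_relation_def)
qed

lemma balanced_iff_nonneg_relation:
  assumes "finite X"
  shows "balanced z X \<longleftrightarrow> (\<exists>c. nonneg_relation z X c)"
proof
  assume "balanced z X"
  then obtain k where weights: "\<forall>x\<in>z ` X. 0 \<le> k x" "sum k (z ` X) = 1" "(\<Sum>x\<in>z ` X. k x *\<^sub>R x) = 0"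
    using assms by (auto simp: convex_hull_finite)
  obtain Y where transversal: "Y \<subseteq> X" "inj_on z Y" "z ` X = z ` Y"
    using subset_image_inj[of "z ` X" z X] by auto
  have "linear_relation z Y (\<lambda>v. k (z v))"
    using weights(3)
    by (simp add: linear_relation_def transversal(3) sum.reindex[OF transversal(2)])
  then have "linear_relation z X (\<lambda>v. if v \<in> Y then k (z v) else 0)"
    using linear_relation_extend[OF assms transversal(1), of z "\<lambda>v. k (z v)"] by simp
  moreover have "\<exists>v\<in>Y. k (z v) \<noteq> 0"
    using weights(2) transversal(3) by (metis imageE sum.neutral zero_neq_one)
  ultimately show "\<exists>c. nonneg_relation z X c"
    unfolding nonneg_relation_def using weights(1) transversal(1)
    by (intro exI[of _ "\<lambda>v. if v \<in> Y then k (z v) else 0"]) auto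
next
  assume "\<exists>c. nonneg_relation z X c"
  then obtain c u where relation: "(\<Sum>v\<in>X. c v *\<^sub>R z v) = 0" "\<forall>v\<in>X. 0 \<le> c v" "u \<in> X" "c u \<noteq> 0"
    by (auto simp: nonneg_relation_def linear_relation_def)
  define r where "r = sum c X"
  have "r > 0" unfolding r_def using assms relation by (intro sum_pos2[of X u]) force+
  have "(\<Sum>v\<in>X. (c v / r) *\<^sub>R z v) \<in> convex hull (z ` X)"
    using assms relation(2) \<open>r > 0\<close>
    by (intro convex_sum convex_convex_hull hull_inc imageI)
      (auto simp: r_def simp flip: sum_divide_distrib)
  moreover have "(\<Sum>v\<in>X. (c v / r) *\<^sub>R z v) = (1 / r) *\<^sub>R (\<Sum>v\<in>X. c v *\<^sub>R z v)"
    by (simp add: scaleR_right.sum)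
  ultimately show "balanced z X" using relation(1) by simp
qed

lemma ex_nontrivial_linear_relation:
  fixes z :: "'v \<Rightarrow> 'w::euclidean_space"
  assumes "finite X" "z ` X \<subseteq> W" "dim W < card X"
  obtains c v where "linear_relation z X c" "v \<in> X" "c v \<noteq> 0"
proof (cases "inj_on z X")
  case False
  then obtain a b where equal_pair: "a \<in> X" "b \<in> X" "a \<noteq> b" "z a = z b"
    unfolding inj_on_def by blast
  define c :: "'v \<Rightarrow> real" where "c v = (if v = a then 1 else if v = b then -1 else 0)" for v
  have "(\<Sum>v\<in>X. c v *\<^sub>R z v) = (\<Sum>v\<in>{a, b}. c v *\<^sub>R z v)"
    using assms(1) equal_pair by (intro sum.mono_neutral_right) (auto simp: c_def)
  also have "\<dots> = 0" using equal_pair by (simp add: c_def)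
  finally show thesis using that[of c a] equal_pair(1) by (simp add: linear_relation_def c_def)
next
  case True
  have "dependent (z ` X)"
    using independent_card_le_dim[OF assms(2)] assms(3) True by (auto simp: card_image)
  then obtain k v where "v \<in> X" "k (z v) \<noteq> 0" "(\<Sum>v\<in>z ` X. k v *\<^sub>R v) = 0"
    using dependent_finite[of "z ` X"] assms(1) by auto
  then show thesis
    using that[of "\<lambda>v. k (z v)" v] by (simp add: linear_relation_def sum.reindex[OF True])
qed

lemma ratio_test:
  fixes c k :: "'v \<Rightarrow> real"
  assumes "finite X" "X \<noteq> {}" "\<And>v. v \<in> X \<Longrightarrow> 0 < c v"
  obtains i r where "i \<in> X" "k i = r * c i" "\<And>v. v \<in> X \<Longrightarrow> r * c v \<le> k v"
proof -
  obtain i where minimal: "i \<in> X" "\<And>v. v \<in> X \<Longrightarrow> k i / c i \<le> k v / c v"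
    using arg_min_if_finite[OF assms(1,2), of "\<lambda>v. k v / c v"] by (meson not_less)
  show thesis
  proof
    show "k i = (k i / c i) * c i" using assms(3)[OF minimal(1)] by simp
    show "(k i / c i) * c v \<le> k v" if "v \<in> X" for v
      using minimal(2)[OF that] assms(3)[OF that] by (simp add: pos_le_divide_eq)
  qed (fact minimal)
qed

locale nondegenerate_family =
  fixes z :: "'v \<Rightarrow> 'w::euclidean_space" and U :: "'v set" and W :: "'w set"
  assumes finite_index: "finite U"
    and card_index: "card U = dim W + 2"
    and range_subset: "z ` U \<subseteq> W"
    and nondegenerate: "a \<in> U \<Longrightarrow> b \<in> U \<Longrightarrow> a \<noteq> b \<Longrightarrow> \<not> balanced z (U - {a, b})"
begin

lemma zero_coefficient_unique:
  assumes nonneg: "nonneg_relation z U c" and "a \<in> U" "b \<in> U" "c a = 0" "c b = 0"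
  shows "a = b"
proof (rule ccontr)
  assume "a \<noteq> b"
  have "linear_relation z (U - {a, b}) c"
    by (rule linear_relation_restrict[OF finite_index])
      (use nonneg assms(4,5) in \<open>auto simp: nonneg_relation_def\<close>)
  then have "nonneg_relation z (U - {a, b}) c"
    using nonneg assms(4,5) by (auto simp: nonneg_relation_def)
  then have "balanced z (U - {a, b})"
    using finite_index balanced_iff_nonneg_relation[of "U - {a, b}" z] by blast
  then show False using nondegenerate assms \<open>a \<noteq> b\<close> by blast
qed

lemma balanced_facet_iff:
  assumes "u \<in> U"
  shows "balanced z (U - {u}) \<longleftrightarrow> (\<exists>c. nonneg_relation z U c \<and> c u = 0)"
proof
  assume "balanced z (U - {u})"
  then obtain c where relation: "nonneg_relation z (U - {u}) c"
    using finite_index balanced_iff_nonneg_relation[of "U - {u}"] by blast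
  then have "linear_relation z U (\<lambda>v. if v \<in> U - {u} then c v else 0)"
    using linear_relation_extend[of U "U - {u}" z c] finite_index by (simp add: nonneg_relation_def)
  then show "\<exists>c. nonneg_relation z U c \<and> c u = 0"
    using relation unfolding nonneg_relation_def
    by (intro exI[of _ "\<lambda>v. if v \<in> U - {u} then c v else 0"]) auto
next
  assume "\<exists>c. nonneg_relation z U c \<and> c u = 0"
  then obtain c where relation: "nonneg_relation z U c" "c u = 0" by blast
  have "linear_relation z (U - {u}) c"
    by (rule linear_relation_restrict[OF finite_index])
      (use relation in \<open>auto simp: nonneg_relation_def\<close>)
  then have "nonneg_relation z (U - {u}) c" using relation by (auto simp: nonneg_relation_def)
  then show "balanced z (U - {u})"
    using finite_index balanced_iff_nonneg_relation[of "U - {u}" z] by blast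
qed

lemma coefficient_pos:
  assumes "nonneg_relation z U c" "u \<in> U" "c u = 0" "v \<in> U" "v \<noteq> u"
  shows "0 < c v"
  using assms zero_coefficient_unique[of c u v]
  unfolding nonneg_relation_def by (metis order_less_le)

text \<open>Subtracting as much of \<open>c\<close> from \<open>k\<close> as nonnegativity permits.\<close>

lemma reduce_by_facet_relation:
  assumes facet_relation: "nonneg_relation z U c" and opposite: "u \<in> U" "c u = 0"
    and relation: "linear_relation z U k" "0 \<le> k u"
  obtains r i where "linear_relation z U (\<lambda>v. k v - r * c v)" "\<And>v. v \<in> U \<Longrightarrow> 0 \<le> k v - r * c v"
    "i \<in> U" "i \<noteq> u" "k i - r * c i = 0"
proof -
  have "U - {u} \<noteq> {}" using facet_relation opposite by (auto simp: nonneg_relation_def)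
  then obtain i r where ratio: "i \<in> U - {u}" "k i = r * c i" "\<And>v. v \<in> U - {u} \<Longrightarrow> r * c v \<le> k v"
    using ratio_test[of "U - {u}" c k] finite_index coefficient_pos[OF facet_relation opposite]
    by auto
  show thesis
  proof
    show "linear_relation z U (\<lambda>v. k v - r * c v)"
      using linear_relation_add_scaled[OF relation(1), of c "- r"] facet_relation
      by (simp add: nonneg_relation_def)
    show "0 \<le> k v - r * c v" if "v \<in> U" for v
      using ratio(3)[of v] that opposite(2) relation(2) by (cases "v = u") auto
  qed (use ratio in auto)
qed

lemma relation_proportional:
  assumes facet_relation: "nonneg_relation z U c" and opposite: "u \<in> U" "c u = 0"
    and relation: "linear_relation z U k" "k u = 0"
  obtains r where "\<And>v. v \<in> U \<Longrightarrow> k v = r * c v"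
proof -
  obtain r i where reduced: "linear_relation z U (\<lambda>v. k v - r * c v)" "\<And>v. v \<in> U \<Longrightarrow> 0 \<le> k v - r * c v"
    "i \<in> U" "i \<noteq> u" "k i - r * c i = 0"
    by (rule reduce_by_facet_relation[OF facet_relation opposite relation(1)])
      (use relation(2) in auto)
  have "\<not> nonneg_relation z U (\<lambda>v. k v - r * c v)"
    using zero_coefficient_unique[of "\<lambda>v. k v - r * c v" i u] reduced(3,4,5) opposite relation(2)
    by auto
  then show thesis using that[of r] reduced(1,2) by (auto simp: nonneg_relation_def)
qed

lemma ex_relation_normalized_at:
  assumes facet_relation: "nonneg_relation z U c" and opposite: "u \<in> U" "c u = 0"
  obtains k where "linear_relation z U k" "k u = 1"
proof -
  obtain w where other: "w \<in> U" "w \<noteq> u"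
    using facet_relation opposite by (auto simp: nonneg_relation_def)
  have "dim W < card (U - {w})" using card_index finite_index other(1) by simp
  then obtain k\<^sub>0 v where dependence: "linear_relation z (U - {w}) k\<^sub>0" "v \<in> U - {w}" "k\<^sub>0 v \<noteq> 0"
    using ex_nontrivial_linear_relation[of "U - {w}" z W] finite_index range_subset by blast
  define k where "k x = (if x \<in> U - {w} then k\<^sub>0 x else 0)" for x
  have extended: "linear_relation z U k" "k w = 0" "k v \<noteq> 0"
    using linear_relation_extend[of U "U - {w}" z k\<^sub>0] finite_index dependence
    by (auto simp: k_def[abs_def])
  have "k u \<noteq> 0"
  proof
    assume "k u = 0"
    then obtain r where multiple: "\<And>x. x \<in> U \<Longrightarrow> k x = r * c x"
      using relation_proportional[OF facet_relation opposite extended(1)] by blast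
    then have "r = 0"
      using coefficient_pos[OF facet_relation opposite other] extended(2) other(1) by auto
    then show False using multiple extended(3) dependence(2) by auto
  qed
  moreover have "linear_relation z U (\<lambda>x. (1 / k u) * k x)"
    using linear_relation_add_scaled[of z U "\<lambda>_. 0" k "1 / k u"] extended(1)
    by (simp add: linear_relation_def)
  ultimately show thesis using that[of "\<lambda>x. (1 / k u) * k x"] by simp
qed

text \<open>The nonnegative relations, up to scaling, form a segment, and the balanced facets are the
  supports of its two end points.\<close>

lemma ex1_other_balanced_facet:
  assumes facet: "u \<in> U" "balanced z (U - {u})"
  shows "\<exists>!i. i \<in> U - {u} \<and> balanced z (U - {i})"
proof -
  obtain c where facet_relation: "nonneg_relation z U c" "c u = 0"
    using balanced_facet_iff facet by blast
  obtain k where normalized: "linear_relation z U k" "k u = 1"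
    using ex_relation_normalized_at[OF facet_relation(1) facet(1) facet_relation(2)] by blast
  obtain r i where reduced: "linear_relation z U (\<lambda>v. k v - r * c v)" "\<And>v. v \<in> U \<Longrightarrow> 0 \<le> k v - r * c v"
    "i \<in> U" "i \<noteq> u" "k i - r * c i = 0"
    by (rule reduce_by_facet_relation[OF facet_relation(1) facet(1) facet_relation(2) normalized(1)])
      (use normalized(2) in auto)
  define e where "e v = k v - r * c v" for v
  have end_point: "nonneg_relation z U e" "e u = 1" "e i = 0"
    using reduced facet_relation(2) normalized(2) facet(1)
    by (auto simp: nonneg_relation_def e_def[abs_def] intro!: bexI[of _ u])
  show ?thesis
  proof (rule ex1I[of _ i])
    show "i \<in> U - {u} \<and> balanced z (U - {i})" using reduced end_point balanced_facet_iff by blast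
    fix j assume other_facet: "j \<in> U - {u} \<and> balanced z (U - {j})"
    then obtain f where other_relation: "nonneg_relation z U f" "f j = 0"
      using balanced_facet_iff by blast
    have other_pos: "0 < f u"
      using coefficient_pos[OF other_relation(1) _ other_relation(2) facet(1)] other_facet by blast
    have "linear_relation z U (\<lambda>v. f v + (- f u) * e v)"
      using other_relation(1) end_point(1)
      by (intro linear_relation_add_scaled) (auto simp: nonneg_relation_def)
    then obtain m where multiple: "\<And>v. v \<in> U \<Longrightarrow> f v - f u * e v = m * c v"
      using end_point(2) relation_proportional[OF facet_relation(1) facet(1) facet_relation(2),
          of "\<lambda>v. f v + (- f u) * e v"] by auto
    have pos: "0 < c i" "0 < c j"
      using coefficient_pos[OF facet_relation(1) facet(1) facet_relation(2)] reduced other_facet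
      by auto
    have "0 \<le> m * c i"
      using multiple[OF reduced(3)] end_point(3) other_relation(1) reduced(3)
      by (auto simp: nonneg_relation_def)
    then have "0 \<le> m * c j" using pos by (simp add: zero_le_mult_iff)
    moreover have "0 \<le> f u * e j"
      using other_pos end_point(1) other_facet by (auto simp: nonneg_relation_def)
    moreover have "- (f u * e j) = m * c j"
      using multiple[of j] other_facet other_relation(2) by simp
    ultimately have "f u * e j = 0" by linarith
    then have "e j = 0" using other_pos by simp
    then show "j = i"
      using zero_coefficient_unique[OF end_point(1)] end_point(3) reduced(3) other_facet by blast
  qed
qed

lemma even_card_balanced_facets: "even (card {u\<in>U. balanced z (U - {u})})"
proof (cases "\<exists>u\<in>U. balanced z (U - {u})")
  case True
  then obtain u i where "u \<in> U" "balanced z (U - {u})" "i \<noteq> u"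
    "{u\<in>U. balanced z (U - {u})} = {u, i}"
    using ex1_other_balanced_facet by blast
  then show ?thesis by simp
qed (metis (no_types, lifting) card.empty empty_Collect_eq even_zero)

end

lemma even_card_balanced_cones:
  fixes z :: "'v \<Rightarrow> 'w::euclidean_space"
  assumes "finite s" "card s = dim W + 1" "z ` s \<subseteq> W" "w \<in> W"
    and facet: "\<And>a. a \<in> s \<Longrightarrow> \<not> balanced z (s - {a})"
    and generic: "\<And>a b. a \<in> s \<Longrightarrow> b \<in> s \<Longrightarrow> a \<noteq> b \<Longrightarrow> w \<notin> span (z ` (s - {a, b}))"
  shows "even (card {u\<in>s. 0 \<in> convex hull insert w (z ` (s - {u}))} + of_bool (balanced z s))"
proof -
  define U where "U = insert None (Some ` s)" \<comment> \<open>\<open>None\<close> is the apex of the cone over \<open>s\<close>\<close>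
  define y where "y = case_option w z"
  have y_Some: "y ` Some ` X = z ` X" for X by (simp add: image_image y_def)
  have y_None: "y None = w" by (simp add: y_def)
  have mem_U: "u \<in> U \<longleftrightarrow> u = None \<or> u \<in> Some ` s" for u by (auto simp: U_def)
  have minus: "U - {None} = Some ` s" "U - {Some u} = insert None (Some ` (s - {u}))"
    "U - {Some u, Some v} = insert None (Some ` (s - {u, v}))" for u v
    by (auto simp: U_def)
  interpret nondegenerate_family y U W
  proof
    show "finite U" "card U = dim W + 2" "y ` U \<subseteq> W"
      using assms(1-4) by (auto simp: U_def card_image y_def)
    have base: "\<not> balanced y (U - {None, Some a})" if "a \<in> s" for a
    proof -
      have "U - {None, Some a} = Some ` (s - {a})" by (auto simp: U_def)
      then show ?thesis using facet[OF that] y_Some by simp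
    qed
    fix a b assume distinct_pair: "a \<in> U" "b \<in> U" "a \<noteq> b"
    then consider a' where "a' \<in> s" "{a, b} = {None, Some a'}"
      | a' b' where "a' \<in> s" "b' \<in> s" "a' \<noteq> b'" "a = Some a'" "b = Some b'"
      unfolding U_def by blast
    then show "\<not> balanced y (U - {a, b})"
    proof cases
      case 1
      then show ?thesis using base by simp
    next
      case 2
      have "\<not> balanced z (s - {a', b'})"
        using facet[OF 2(1)] balanced_mono[of z "s - {a', b'}" "s - {a'}"] by blast
      then show ?thesis
        using zero_in_convex_hull_insert_imp[OF _ generic[OF 2(1-3)]]
        by (auto simp: 2(4,5) minus y_Some y_None)
    qed
  qed
  have "{u\<in>U. balanced y (U - {u})} =
      Some ` {u\<in>s. 0 \<in> convex hull insert w (z ` (s - {u}))} \<union> (if balanced z s then {None} else {})"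
    using mem_U by (auto simp: minus y_Some y_None)
  then have "card {u\<in>U. balanced y (U - {u})} =
      card {u\<in>s. 0 \<in> convex hull insert w (z ` (s - {u}))} + of_bool (balanced z s)"
    using assms(1) by (simp add: card_image image_iff)
  then show ?thesis using even_card_balanced_facets by simp
qed

section \<open>Free actions of the Klein four-group\<close>

locale free_klein_four_action =
  fixes V :: "'v set" and g h :: "'v \<Rightarrow> 'v"
  assumes g_closed: "v \<in> V \<Longrightarrow> g v \<in> V" and h_closed: "v \<in> V \<Longrightarrow> h v \<in> V"
    and g_g: "v \<in> V \<Longrightarrow> g (g v) = v" and h_h: "v \<in> V \<Longrightarrow> h (h v) = v"
    and h_g: "v \<in> V \<Longrightarrow> h (g v) = g (h v)"
    and g_free: "v \<in> V \<Longrightarrow> g v \<noteq> v" and h_free: "v \<in> V \<Longrightarrow> h v \<noteq> v"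
    and gh_free: "v \<in> V \<Longrightarrow> g (h v) \<noteq> v"
begin

lemma inj_on_g: "inj_on g V" and inj_on_h: "inj_on h V"
  using g_g h_h by (metis inj_onI)+

definition orbit :: "'v \<Rightarrow> 'v set" where
  "orbit v = {v, g v, h v, g (h v)}"

lemma orbit_subset: "v \<in> V \<Longrightarrow> orbit v \<subseteq> V"
  using g_closed h_closed by (simp add: orbit_def)

lemma orbit_distinct:
  assumes "v \<in> V"
  shows "g v \<noteq> v" "h v \<noteq> v" "g (h v) \<noteq> v" "g v \<noteq> h v" "g v \<noteq> g (h v)" "h v \<noteq> g (h v)"
  using assms g_free h_free gh_free g_g h_closed by metis+

lemma card_orbit: "v \<in> V \<Longrightarrow> card (orbit v) = 4"
  using orbit_distinct[of v] by (auto simp: orbit_def)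

lemma orbit_g: "v \<in> V \<Longrightarrow> orbit (g v) = orbit v" and orbit_h: "v \<in> V \<Longrightarrow> orbit (h v) = orbit v"
  using g_g h_h h_g h_closed by (auto simp: orbit_def)

lemma orbit_eq: "u \<in> orbit v \<Longrightarrow> v \<in> V \<Longrightarrow> orbit u = orbit v"
  using orbit_g orbit_h h_closed by (auto simp: orbit_def[of v])

lemma g_in_orbit_iff: "v \<in> V \<Longrightarrow> p \<in> V \<Longrightarrow> g v \<in> orbit p \<longleftrightarrow> v \<in> orbit p"
  and h_in_orbit_iff: "v \<in> V \<Longrightarrow> p \<in> V \<Longrightarrow> h v \<in> orbit p \<longleftrightarrow> v \<in> orbit p"
  using orbit_eq[of "g v" p] orbit_eq[of "h v" p] orbit_eq[of v p] orbit_g orbit_h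
  by (metis insertI1 orbit_def)+

definition extend_to_orbit :: "('l \<Rightarrow> 'l) \<Rightarrow> 'v \<Rightarrow> 'l \<Rightarrow> 'v \<Rightarrow> 'l" where
  "extend_to_orbit flip p l v = (if v \<in> {p, g (h p)} then l else flip l)"

lemma extend_to_orbit_equivariant:
  assumes "p \<in> V" "v \<in> orbit p" "flip (flip l) = l"
  shows "extend_to_orbit flip p l (g v) = flip (extend_to_orbit flip p l v)"
    "extend_to_orbit flip p l (h v) = flip (extend_to_orbit flip p l v)"
  using assms orbit_distinct[OF assms(1)] g_g[of p] g_g[of "h p"] h_h[of p] h_g h_closed g_closed
  unfolding orbit_def extend_to_orbit_def by auto

lemma ex_equivariant_choice:
  assumes ex: "\<And>v. v \<in> V \<Longrightarrow> \<exists>l. P v l"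
    and P_g: "\<And>v l. v \<in> V \<Longrightarrow> P v l \<Longrightarrow> P (g v) (flip l)"
    and P_h: "\<And>v l. v \<in> V \<Longrightarrow> P v l \<Longrightarrow> P (h v) (flip l)"
    and flip: "\<And>l. flip (flip l) = l"
  shows "\<exists>L. \<forall>v\<in>V. P v (L v) \<and> L (g v) = flip (L v) \<and> L (h v) = flip (L v)"
proof -
  define r where "r v = (SOME u. u \<in> orbit v)" for v
  obtain l where choice: "\<And>v. v \<in> V \<Longrightarrow> P v (l v)" using ex by metis
  define L where "L v = extend_to_orbit flip (r v) (l (r v)) v" for v
  have rep_invariant: "r (g v) = r v" "r (h v) = r v" if "v \<in> V" for v
    using that by (simp_all add: r_def orbit_g orbit_h)
  have "r v \<in> orbit v" for v unfolding r_def by (rule someI[of _ v]) (simp add: orbit_def)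
  then have rep: "r v \<in> V" "v \<in> orbit (r v)" if "v \<in> V" for v
    using that orbit_subset orbit_eq by (blast, metis insertI1 orbit_def)
  have "P v (L v)" if "v \<in> V" for v
  proof -
    let ?r = "r v"
    have "P ?r (l ?r)" "P (g ?r) (flip (l ?r))" "P (h ?r) (flip (l ?r))" "P (g (h ?r)) (l ?r)"
      using choice P_g P_h flip rep(1)[OF that] h_closed by metis+
    moreover have "v = ?r \<or> v = g ?r \<or> v = h ?r \<or> v = g (h ?r)"
      using rep(2)[OF that] by (auto simp: orbit_def)
    ultimately show ?thesis
      using orbit_distinct[OF rep(1)[OF that]] unfolding L_def extend_to_orbit_def by auto
  qed
  moreover have "L (g v) = flip (L v)" "L (h v) = flip (L v)" if "v \<in> V" for v
    using extend_to_orbit_equivariant[OF rep[OF that], of flip] flip rep_invariant[OF that]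
    by (simp_all add: L_def)
  ultimately show ?thesis by blast
qed

end

section \<open>Counting balanced simplices modulo 8\<close>

definition odd_labelling ::
  "'v set set \<Rightarrow> ('v \<Rightarrow> 'v) \<Rightarrow> ('v \<Rightarrow> 'v) \<Rightarrow> ('v \<Rightarrow> 'w::real_vector) \<Rightarrow> bool" where
  "odd_labelling F g h z \<longleftrightarrow> (\<forall>v\<in>\<Union>F. z (g v) = - z v \<and> z (h v) = - z v)"

lemma odd_labellingD:
  assumes "odd_labelling F g h z" "v \<in> \<Union>F"
  shows "z (g v) = - z v" "z (h v) = - z v"
  using assms unfolding odd_labelling_def by blast+

definition generic_labelling :: "'v set set \<Rightarrow> ('v \<Rightarrow> 'w::real_vector) \<Rightarrow> bool" where
  "generic_labelling F z \<longleftrightarrow> (\<forall>s\<in>F. \<forall>v\<in>s. \<not> balanced z (s - {v}))"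

definition num_balanced :: "'v set set \<Rightarrow> ('v \<Rightarrow> 'w::real_vector) \<Rightarrow> nat" where
  "num_balanced F z = card {s\<in>F. balanced z s}"

lemma num_balanced_cong:
  assumes "\<And>s v. s \<in> F \<Longrightarrow> v \<in> s \<Longrightarrow> y v = z v"
  shows "num_balanced F y = num_balanced F z"
proof -
  have "y ` s = z ` s" if "s \<in> F" for s using assms that by auto
  then show ?thesis unfolding num_balanced_def by (metis (mono_tags, lifting))
qed

lemma num_balanced_eq_sum: "finite F \<Longrightarrow> num_balanced F z = (\<Sum>s\<in>F. of_bool (balanced z s))"
  by (simp add: num_balanced_def sum_of_bool_eq Int_def)

lemma add_4_mult_mod_8_eq:
  fixes a b c :: nat
  assumes "even (b + c)"
  shows "(a + 4 * c) mod 8 = (a + 4 * b) mod 8"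
proof -
  obtain k where "b + c = 2 * k" using assms by (rule evenE)
  then have "a + 4 * c + b * 8 = a + 4 * b + k * 8" by simp
  then show ?thesis by (metis mod_mult_self1)
qed

locale graded_complex = free_klein_four_action "\<Union>F" g h
  for F :: "'v set set" and g h :: "'v \<Rightarrow> 'v" +
  fixes n :: nat and rk :: "'v \<Rightarrow> nat"
  assumes dim_pos: "0 < n"
    and finite_complex: "finite F"
    and rk_bij: "s \<in> F \<Longrightarrow> bij_betw rk s {..n}"
    and even_facet: "s \<in> F \<Longrightarrow> v \<in> s \<Longrightarrow> even (card {t\<in>F. s - {v} \<subseteq> t})"
    and g_simplex: "s \<in> F \<Longrightarrow> g ` s \<in> F" and h_simplex: "s \<in> F \<Longrightarrow> h ` s \<in> F"
    and rk_g: "v \<in> \<Union>F \<Longrightarrow> rk (g v) = rk v" and rk_h: "v \<in> \<Union>F \<Longrightarrow> rk (h v) = rk v"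
begin

lemma finite_simplex: "s \<in> F \<Longrightarrow> finite s"
  using rk_bij bij_betw_finite by blast

lemma card_simplex: "s \<in> F \<Longrightarrow> card s = n + 1"
  using rk_bij bij_betw_same_card by fastforce

lemma finite_verts: "finite (\<Union>F)"
  using finite_complex finite_simplex by blast

lemma rk_inj: "s \<in> F \<Longrightarrow> u \<in> s \<Longrightarrow> v \<in> s \<Longrightarrow> rk u = rk v \<Longrightarrow> u = v"
  using rk_bij by (meson bij_betw_def inj_onD)

lemma rk_orbit: "q \<in> orbit p \<Longrightarrow> p \<in> \<Union>F \<Longrightarrow> rk q = rk p"
  using rk_g[of p] rk_h[of p] rk_g[OF h_closed[of p]] unfolding orbit_def by force

lemma simplex_orbit_unique:
  assumes "s \<in> F" "u \<in> s" "v \<in> s" "u \<in> orbit p" "v \<in> orbit p" "p \<in> \<Union>F"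
  shows "u = v"
  using assms rk_inj rk_orbit by metis

definition star :: "'v \<Rightarrow> 'v set set" where
  "star p = {s\<in>F. p \<in> s}"

lemma finite_star: "finite (star p)"
  using finite_complex by (simp add: star_def)

lemma num_balanced_star_symmetric:
  assumes involution: "\<And>v. v \<in> \<Union>F \<Longrightarrow> f (f v) = v" "\<And>s. s \<in> F \<Longrightarrow> f ` s \<in> F"
    and odd: "\<And>v. v \<in> \<Union>F \<Longrightarrow> z (f v) = - z v" and "v \<in> \<Union>F"
  shows "num_balanced (star (f v)) z = num_balanced (star v) z"
proof -
  have f_f: "f ` f ` s = s" if "s \<in> F" for s
    using involution(1) that by (force simp: image_image)
  have bal: "balanced z (f ` s) \<longleftrightarrow> balanced z s" if "s \<in> F" for s
  proof -
    have "z ` f ` s = (\<lambda>v. - z v) ` s"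
      unfolding image_image using odd that by (intro image_cong) auto
    then show ?thesis using balanced_uminus[of z s] by simp
  qed
  have mem: "f v \<in> f ` s \<longleftrightarrow> v \<in> s" if "s \<in> F" for s
    using f_f[OF that] involution(1)[OF \<open>v \<in> \<Union>F\<close>] by (metis imageI)
  have "bij_betw ((`) f) {s\<in>star v. balanced z s} {s\<in>star (f v). balanced z s}"
  proof (rule bij_betwI[where g = "(`) f"])
    show "(`) f \<in> {s\<in>star v. balanced z s} \<rightarrow> {s\<in>star (f v). balanced z s}"
      by (auto simp: star_def bal involution(2))
    show "(`) f \<in> {s\<in>star (f v). balanced z s} \<rightarrow> {s\<in>star v. balanced z s}"
      using mem[OF involution(2)] by (auto simp: star_def bal f_f involution(2))
  qed (auto simp: star_def f_f)
  then show ?thesis by (simp add: num_balanced_def bij_betw_same_card)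
qed

lemma num_balanced_star_orbit:
  assumes "odd_labelling F g h z" "p \<in> \<Union>F" "q \<in> orbit p"
  shows "num_balanced (star q) z = num_balanced (star p) z"
proof -
  have "num_balanced (star (g v)) z = num_balanced (star v) z"
    "num_balanced (star (h v)) z = num_balanced (star v) z" if "v \<in> \<Union>F" for v
    using odd_labellingD[OF assms(1)] num_balanced_star_symmetric[OF g_g g_simplex _ that, of z]
      num_balanced_star_symmetric[OF h_h h_simplex _ that, of z] by blast+
  note this[OF assms(2)] this(1)[OF h_closed[OF assms(2)]]
  then show ?thesis using assms(3) by (auto simp: orbit_def)
qed

lemma num_balanced_split_orbit:
  assumes "odd_labelling F g h z" "p \<in> \<Union>F"
  shows "num_balanced F z =
    num_balanced {s\<in>F. s \<inter> orbit p = {}} z + 4 * num_balanced (star p) z"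
proof -
  define N where "N q = {s\<in>star q. balanced z s}" for q
  have "card (\<Union>q\<in>orbit p. N q) = (\<Sum>q\<in>orbit p. card (N q))"
    using simplex_orbit_unique[OF _ _ _ _ _ assms(2)] finite_complex
    by (intro card_UN_disjoint) (auto simp: N_def star_def orbit_def[of p])
  also have "\<dots> = 4 * num_balanced (star p) z"
    using num_balanced_star_orbit[OF assms] card_orbit[OF assms(2)]
    by (simp add: N_def num_balanced_def)
  finally have "card (\<Union>q\<in>orbit p. N q) = 4 * num_balanced (star p) z" .
  moreover have "{s\<in>F. balanced z s} =
      {s\<in>{s\<in>F. s \<inter> orbit p = {}}. balanced z s} \<union> (\<Union>q\<in>orbit p. N q)"
    by (auto simp: N_def star_def)
  moreover have "{s\<in>{s\<in>F. s \<inter> orbit p = {}}. balanced z s} \<inter> (\<Union>q\<in>orbit p. N q) = {}"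
    by (auto simp: N_def star_def)
  ultimately show ?thesis
    using finite_complex finite_star
    by (simp add: num_balanced_def card_Un_disjoint N_def orbit_def)
qed

text \<open>Each facet through \<open>p\<close> lies in evenly many simplices, all of them in the star of \<open>p\<close>.\<close>

lemma even_card_star_facets: "even (\<Sum>s\<in>star p. card {u\<in>s - {p}. Q (s - {u})})"
proof -
  define \<Phi> where "\<Phi> = {f. Q f \<and> p \<in> f \<and> (\<exists>s\<in>F. \<exists>u\<in>s. f = s - {u})}"
  have "\<Phi> \<subseteq> Pow (\<Union>F)" by (auto simp: \<Phi>_def)
  then have finite_\<Phi>: "finite \<Phi>" using finite_verts finite_subset by blast
  have "card {u\<in>s - {p}. Q (s - {u})} = card {f\<in>\<Phi>. f \<subseteq> s}" if in_star: "s \<in> star p" for s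
  proof (rule bij_betw_same_card[of "\<lambda>u. s - {u}"], unfold bij_betw_def, intro conjI)
    show "inj_on (\<lambda>u. s - {u}) {u\<in>s - {p}. Q (s - {u})}" by (rule inj_onI) blast
    show "(\<lambda>u. s - {u}) ` {u\<in>s - {p}. Q (s - {u})} = {f\<in>\<Phi>. f \<subseteq> s}"
    proof (intro equalityI subsetI)
      fix f assume "f \<in> {f\<in>\<Phi>. f \<subseteq> s}"
      then obtain t v where facet: "Q f" "p \<in> f" "f \<subseteq> s" "t \<in> F" "v \<in> t" "f = t - {v}"
        by (auto simp: \<Phi>_def)
      have simplex: "s \<in> F" using in_star by (simp add: star_def)
      have "card (s - f) = 1"
        using facet card_simplex finite_simplex simplex
        by (simp add: card_Diff_subset finite_subset)
      then obtain u where "s - f = {u}" by (auto simp: card_1_singleton_iff)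
      then have "u \<in> s - {p}" "f = s - {u}" using facet by auto
      then show "f \<in> (\<lambda>u. s - {u}) ` {u\<in>s - {p}. Q (s - {u})}" using facet(1) by blast
    qed (use in_star in \<open>auto simp: \<Phi>_def star_def\<close>)
  qed
  then have "(\<Sum>s\<in>star p. card {u\<in>s - {p}. Q (s - {u})}) = (\<Sum>s\<in>star p. card {f\<in>\<Phi>. f \<subseteq> s})"
    by simp
  also have "\<dots> = (\<Sum>f\<in>\<Phi>. card {s\<in>star p. f \<subseteq> s})"
    using finite_star finite_\<Phi> by (intro sum_multicount_gen) auto
  also have "\<dots> = (\<Sum>f\<in>\<Phi>. card {s\<in>F. f \<subseteq> s})"
  proof (rule sum.cong)
    fix f assume "f \<in> \<Phi>"
    then have "{s\<in>star p. f \<subseteq> s} = {s\<in>F. f \<subseteq> s}" by (auto simp: \<Phi>_def star_def)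
    then show "card {s\<in>star p. f \<subseteq> s} = card {s\<in>F. f \<subseteq> s}" by simp
  qed simp
  finally show ?thesis using even_facet by (auto simp: \<Phi>_def intro!: dvd_sum)
qed

text \<open>Cone off every simplex \<open>s\<close> of the star of \<open>p\<close> with a vertex labelled \<open>w\<close>. The cone over the
  facet opposite to \<open>p\<close> carries the labels that \<open>s\<close> gets when \<open>p\<close> is relabelled \<open>w\<close>, and each of the
  other cones is shared by evenly many simplices.\<close>

lemma even_num_balanced_star_change:
  fixes z :: "'v \<Rightarrow> 'w::euclidean_space"
  assumes gen: "generic_labelling F z" and labels: "dim W = n" "z ` \<Union>F \<subseteq> W" "w \<in> W"
    and avoids: "\<And>s a b. s \<in> F \<Longrightarrow> a \<in> s \<Longrightarrow> b \<in> s \<Longrightarrow> a \<noteq> b \<Longrightarrow> w \<notin> span (z ` (s - {a, b}))"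
  shows "even (num_balanced (star p) z + num_balanced (star p) (z(p := w)))"
proof -
  define Q where "Q f \<longleftrightarrow> 0 \<in> convex hull insert w (z ` f)" for f
  have "even (of_bool (balanced z s) + of_bool (balanced (z(p := w)) s) +
      card {u\<in>s - {p}. Q (s - {u})})" if "s \<in> star p" for s
  proof -
    have simplex: "s \<in> F" "p \<in> s" using that by (auto simp: star_def)
    have "(z(p := w)) ` s = insert w (z ` (s - {p}))" using simplex(2) by auto
    then have Q_p: "Q (s - {p}) \<longleftrightarrow> balanced (z(p := w)) s" by (simp add: Q_def)
    have "{u\<in>s. Q (s - {u})} = {u\<in>s - {p}. Q (s - {u})} \<union> (if Q (s - {p}) then {p} else {})"
      using simplex(2) by auto
    then have "card {u\<in>s. Q (s - {u})} =
        card {u\<in>s - {p}. Q (s - {u})} + of_bool (balanced (z(p := w)) s)"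
      using finite_simplex[OF simplex(1)] by (simp add: Q_p)
    moreover have "even (card {u\<in>s. Q (s - {u})} + of_bool (balanced z s))"
      unfolding Q_def
    proof (rule even_card_balanced_cones)
      show "finite s" "card s = dim W + 1"
        using finite_simplex card_simplex simplex(1) labels(1) by simp_all
      show "z ` s \<subseteq> W" using labels(2) simplex(1) by blast
      show "\<not> balanced z (s - {a})" if "a \<in> s" for a
        using gen simplex(1) that by (simp add: generic_labelling_def)
    qed (use labels(3) avoids[OF simplex(1)] in blast)+
    ultimately show ?thesis by (simp add: ac_simps)
  qed
  then have "even (\<Sum>s\<in>star p. of_bool (balanced z s) + of_bool (balanced (z(p := w)) s) +
      card {u\<in>s - {p}. Q (s - {u})})"
    by (rule dvd_sum)
  then show ?thesis
    using even_card_star_facets[of p Q] by (simp add: sum.distrib num_balanced_eq_sum finite_star)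
qed

definition relabel_orbit :: "'v \<Rightarrow> 'w::real_vector \<Rightarrow> ('v \<Rightarrow> 'w) \<Rightarrow> 'v \<Rightarrow> 'w" where
  "relabel_orbit p w z v = (if v \<in> orbit p then extend_to_orbit uminus p w v else z v)"

lemma relabel_orbit_cases: "v \<in> orbit p \<Longrightarrow> relabel_orbit p w z v = w \<or> relabel_orbit p w z v = - w"
  by (simp add: relabel_orbit_def extend_to_orbit_def)

lemma odd_labelling_relabel_orbit:
  assumes "odd_labelling F g h z" "p \<in> \<Union>F"
  shows "odd_labelling F g h (relabel_orbit p w z)"
  unfolding odd_labelling_def
proof (intro ballI)
  fix v assume vertex: "v \<in> \<Union>F"
  then show "relabel_orbit p w z (g v) = - relabel_orbit p w z v \<and>
      relabel_orbit p w z (h v) = - relabel_orbit p w z v"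
    using odd_labellingD[OF assms(1)] g_in_orbit_iff[OF vertex assms(2)]
      h_in_orbit_iff[OF vertex assms(2)]
      extend_to_orbit_equivariant[where flip = uminus and l = w, OF assms(2) _ minus_minus]
    by (simp add: relabel_orbit_def)
qed

lemma generic_labelling_relabel_orbit:
  assumes gen: "generic_labelling F z" and vertex: "p \<in> \<Union>F"
    and avoids: "\<And>s a b. s \<in> F \<Longrightarrow> a \<in> s \<Longrightarrow> b \<in> s \<Longrightarrow> a \<noteq> b \<Longrightarrow> w \<notin> span (z ` (s - {a, b}))"
  shows "generic_labelling F (relabel_orbit p w z)"
  unfolding generic_labelling_def
proof (intro ballI notI)
  let ?y = "relabel_orbit p w z"
  fix s a assume simplex: "s \<in> F" "a \<in> s" and bal: "balanced ?y (s - {a})"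
  have not_bal: "\<not> balanced z (s - {a})" using gen simplex by (simp add: generic_labelling_def)
  show False
  proof (cases "orbit p \<inter> (s - {a}) = {}")
    case True
    then have "?y ` (s - {a}) = z ` (s - {a})"
      by (intro image_cong) (auto simp: relabel_orbit_def)
    then show False using bal not_bal by simp
  next
    case False
    then obtain b where moved: "b \<in> orbit p" "b \<in> s" "b \<noteq> a" by auto
    have "?y v = z v" if "v \<in> s - {a, b}" for v
      using that simplex_orbit_unique[OF simplex(1) _ moved(2) _ moved(1) vertex]
      by (auto simp: relabel_orbit_def)
    then have "?y ` (s - {a, b}) = z ` (s - {a, b})" by (rule image_cong[OF refl])
    moreover have "s - {a} = insert b (s - {a, b})" using moved(2,3) by auto
    ultimately have "?y ` (s - {a}) = insert (?y b) (z ` (s - {a, b}))" by (metis image_insert)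
    moreover have "?y b \<notin> span (z ` (s - {a, b}))"
      using relabel_orbit_cases[OF moved(1)] avoids[OF simplex moved(2)] moved(3)
      by (metis minus_minus span_neg)
    ultimately have "balanced z (s - {a, b})"
      using zero_in_convex_hull_insert_imp bal by metis
    then show False using not_bal balanced_mono[of z "s - {a, b}" "s - {a}"] by blast
  qed
qed

lemma num_balanced_relabel_orbit:
  fixes z :: "'v \<Rightarrow> 'w::euclidean_space"
  assumes odd: "odd_labelling F g h z" and gen: "generic_labelling F z"
    and labels: "dim W = n" "z ` \<Union>F \<subseteq> W" "w \<in> W" and vertex: "p \<in> \<Union>F"
    and avoids: "\<And>s a b. s \<in> F \<Longrightarrow> a \<in> s \<Longrightarrow> b \<in> s \<Longrightarrow> a \<noteq> b \<Longrightarrow> w \<notin> span (z ` (s - {a, b}))"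
  shows "num_balanced F (relabel_orbit p w z) mod 8 = num_balanced F z mod 8"
proof -
  let ?y = "relabel_orbit p w z" and ?F' = "{s\<in>F. s \<inter> orbit p = {}}"
  have "num_balanced ?F' ?y = num_balanced ?F' z"
    by (rule num_balanced_cong) (auto simp: relabel_orbit_def)
  moreover have "num_balanced (star p) ?y = num_balanced (star p) (z(p := w))"
  proof (rule num_balanced_cong)
    fix s v assume "s \<in> star p" "v \<in> s"
    then show "?y v = (z(p := w)) v"
      using simplex_orbit_unique[of s v p p] vertex
      by (auto simp: star_def relabel_orbit_def extend_to_orbit_def orbit_def)
  qed
  ultimately have relabelled_count: "num_balanced F ?y =
      num_balanced ?F' z + 4 * num_balanced (star p) (z(p := w))"
    using num_balanced_split_orbit[OF odd_labelling_relabel_orbit[OF odd vertex] vertex] by simp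
  have "even (num_balanced (star p) z + num_balanced (star p) (z(p := w)))"
    using avoids by (rule even_num_balanced_star_change[OF gen labels])
  then show ?thesis
    unfolding relabelled_count num_balanced_split_orbit[OF odd vertex] by (rule add_4_mult_mod_8_eq)
qed

end

lemma near_point_avoiding_subspaces:
  fixes y :: "'w::euclidean_space"
  assumes ambient: "subspace W" "y \<in> W" and "finite \<U>" "0 < \<epsilon>"
    and small: "\<And>U. U \<in> \<U> \<Longrightarrow> subspace U \<and> dim U < dim W"
  obtains w where "w \<in> W" "dist w y < \<epsilon>" "\<And>U. U \<in> \<U> \<Longrightarrow> w \<notin> U"
proof -
  define \<G> where "\<G> = insert W ((-) W ` \<U>)"
  have "openin (top_of_set W) (W - U) \<and> W \<subseteq> closure (W - U)" if "U \<in> \<U>" for U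
    using small[OF that] dense_complement_subspace[of U W] ambient(1)
    by (simp add: Diff_eq openin_open_Int open_Compl closed_subspace)
  then have "W \<subseteq> closure (\<Inter>\<G>)"
    using \<open>finite \<U>\<close> ambient(1) closure_subset
    by (intro Baire) (auto simp: \<G>_def closed_subspace countable_finite)
  then obtain w where "w \<in> \<Inter>\<G>" "dist w y < \<epsilon>"
    using ambient(2) \<open>0 < \<epsilon>\<close> by (meson closure_approachable subsetD)
  then show thesis using that[of w] by (auto simp: \<G>_def split: if_splits)
qed

context graded_complex
begin

lemma ex_generic_label:
  fixes z :: "'v \<Rightarrow> 'w::euclidean_space"
  assumes ambient: "subspace W" "dim W = n" and target: "y \<in> W" and "0 < \<epsilon>"
  obtains w where "w \<in> W" "dist w y < \<epsilon>"
    "\<And>s a b. s \<in> F \<Longrightarrow> a \<in> s \<Longrightarrow> b \<in> s \<Longrightarrow> a \<noteq> b \<Longrightarrow> w \<notin> span (z ` (s - {a, b}))"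
proof -
  define I where "I = (SIGMA s:F. SIGMA a:s. {b\<in>s. a \<noteq> b})"
  define \<U> where "\<U> = (\<lambda>(s, a, b). span (z ` (s - {a, b}))) ` I"
  have "finite \<U>"
    using finite_complex finite_simplex by (auto simp: \<U>_def I_def)
  moreover have "subspace U \<and> dim U < dim W" if "U \<in> \<U>" for U
  proof -
    obtain s a b where simplex: "s \<in> F" "a \<in> s" "b \<in> s" "a \<noteq> b" "U = span (z ` (s - {a, b}))"
      using \<open>U \<in> \<U>\<close> by (auto simp: \<U>_def I_def)
    have "dim U \<le> card (z ` (s - {a, b}))"
      using finite_simplex[OF simplex(1)] by (simp add: simplex(5) dim_le_card')
    also have "\<dots> \<le> card (s - {a, b})"
      using finite_simplex[OF simplex(1)] by (intro card_image_le) auto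
    also have "\<dots> = n - 1" using simplex finite_simplex card_simplex by (simp add: card_Diff_subset)
    finally show ?thesis using simplex(5) ambient(2) dim_pos by simp
  qed
  ultimately obtain w where "w \<in> W" "dist w y < \<epsilon>" "\<And>U. U \<in> \<U> \<Longrightarrow> w \<notin> U"
    using near_point_avoiding_subspaces[OF ambient(1) target] \<open>0 < \<epsilon>\<close> by blast
  then show thesis using that[of w] by (force simp: \<U>_def I_def)
qed

end

locale essential_labelling = graded_complex F g h n rk
  for F :: "'v set set" and g h :: "'v \<Rightarrow> 'v" and n :: nat and rk :: "'v \<Rightarrow> nat" +
  fixes W :: "'w::euclidean_space set" and z :: "'v \<Rightarrow> 'w"
  assumes subspace_W: "subspace W" and dim_W: "dim W = n"
    and odd_z: "odd_labelling F g h z" and generic_z: "generic_labelling F z"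
    and z_subset: "z ` \<Union>F \<subseteq> W"
    and not_8_dvd: "\<not> 8 dvd num_balanced F z"
begin

lemma essential_labelling_relabel_orbit:
  assumes "p \<in> \<Union>F" "w \<in> W"
    and "\<And>s a b. s \<in> F \<Longrightarrow> a \<in> s \<Longrightarrow> b \<in> s \<Longrightarrow> a \<noteq> b \<Longrightarrow> w \<notin> span (z ` (s - {a, b}))"
  shows "essential_labelling F g h n rk W (relabel_orbit p w z)"
proof
  show "\<not> 8 dvd num_balanced F (relabel_orbit p w z)"
    using num_balanced_relabel_orbit[OF odd_z generic_z dim_W z_subset assms(2,1,3)] not_8_dvd
    by (simp add: dvd_eq_mod_eq_0)
  show "relabel_orbit p w z ` \<Union>F \<subseteq> W"
    using z_subset assms(2) relabel_orbit_cases[of _ p w z] subspace_neg[OF subspace_W]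
    by (fastforce simp: relabel_orbit_def)
  show "generic_labelling F (relabel_orbit p w z)"
    using assms(3) by (rule generic_labelling_relabel_orbit[OF generic_z assms(1)])
qed (fact subspace_W dim_W odd_labelling_relabel_orbit[OF odd_z assms(1)])+

end

lemma (in graded_complex) ex_essential_labelling_close:
  fixes y z :: "'v \<Rightarrow> 'w::euclidean_space"
  assumes essential: "essential_labelling F g h n rk W z"
    and target: "odd_labelling F g h y" "y ` \<Union>F \<subseteq> W" and "0 < \<epsilon>"
    and "finite P" "P \<subseteq> \<Union>F"
  shows "\<exists>x. essential_labelling F g h n rk W x \<and> (\<forall>v\<in>P. dist (x v) (y v) < \<epsilon>)"
  using assms(5,6)
proof (induction P)
  case empty
  then show ?case using essential by blast
next
  case (insert p P)
  then obtain x where approx: "essential_labelling F g h n rk W x" "\<forall>v\<in>P. dist (x v) (y v) < \<epsilon>"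
    by auto
  interpret essential_labelling F g h n rk W x by fact
  have vertex: "p \<in> \<Union>F" using insert.prems by simp
  obtain w where label: "w \<in> W" "dist w (y p) < \<epsilon>"
    "\<And>s a b. s \<in> F \<Longrightarrow> a \<in> s \<Longrightarrow> b \<in> s \<Longrightarrow> a \<noteq> b \<Longrightarrow> w \<notin> span (x ` (s - {a, b}))"
    using ex_generic_label[OF subspace_W dim_W _ \<open>0 < \<epsilon>\<close>, of "y p" x] target(2) vertex by blast
  have "y (g p) = - y p" "y (h p) = - y p" "y (g (h p)) = y p"
    using odd_labellingD[OF target(1)] vertex h_closed[OF vertex] by simp_all
  then have "dist (relabel_orbit p w x v) (y v) < \<epsilon>" if "v \<in> insert p P" for v
    using that approx(2) label(2)
    by (auto simp: relabel_orbit_def extend_to_orbit_def orbit_def dist_minus)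
  then show ?case using essential_labelling_relabel_orbit[OF vertex label(1,3)] by blast
qed

theorem (in essential_labelling) ex_balanced_simplex:
  assumes target: "odd_labelling F g h y" "y ` \<Union>F \<subseteq> W"
  shows "\<exists>s\<in>F. balanced y s"
proof (rule ccontr)
  assume unbalanced: "\<not> (\<exists>s\<in>F. balanced y s)"
  have "\<exists>\<epsilon>>0. \<forall>x. (\<forall>v\<in>s. dist (x v) (y v) < \<epsilon>) \<longrightarrow> \<not> balanced x s" if "s \<in> F" for s
    using not_balanced_perturbation[OF finite_simplex[OF that], of y] unbalanced that by metis
  then obtain e where margin: "\<And>s. s \<in> F \<Longrightarrow> 0 < e s"
    "\<And>s x. s \<in> F \<Longrightarrow> \<forall>v\<in>s. dist (x v) (y v) < e s \<Longrightarrow> \<not> balanced x s"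
    by metis
  define \<epsilon> where "\<epsilon> = Min (insert 1 (e ` F))"
  have "0 < \<epsilon>" using finite_complex margin(1) by (auto simp: \<epsilon>_def)
  then obtain x where approx: "essential_labelling F g h n rk W x" "\<forall>v\<in>\<Union>F. dist (x v) (y v) < \<epsilon>"
    using ex_essential_labelling_close[OF essential_labelling_axioms target \<open>0 < \<epsilon>\<close>
        finite_verts order_refl] by blast
  have "\<not> balanced x s" if "s \<in> F" for s
  proof (rule margin(2)[OF that])
    have "\<epsilon> \<le> e s" unfolding \<epsilon>_def using finite_complex that by (intro Min_le) auto
    then show "\<forall>v\<in>s. dist (x v) (y v) < e s" using approx(2) that by fastforce
  qed
  then have "{s\<in>F. balanced x s} = {}" by blast
  then have "num_balanced F x = 0" unfolding num_balanced_def by (metis card.empty)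
  then show False using essential_labelling.not_8_dvd[OF approx(1)] by simp
qed

section \<open>Complexes of maximal chains\<close>

definition graded_chains ::
  "nat \<Rightarrow> 'v set \<Rightarrow> ('v \<Rightarrow> nat) \<Rightarrow> ('v \<Rightarrow> 'v \<Rightarrow> bool) \<Rightarrow> 'v set set" where
  "graded_chains n P rk R =
     {s. s \<subseteq> P \<and> bij_betw rk s {..n} \<and> (\<forall>u\<in>s. \<forall>v\<in>s. rk v = Suc (rk u) \<longrightarrow> R u v)}"

lemma graded_chainsD:
  assumes "s \<in> graded_chains n P rk R"
  shows "s \<subseteq> P" "bij_betw rk s {..n}" "finite s" "card s = n + 1"
    and "\<And>u v. u \<in> s \<Longrightarrow> v \<in> s \<Longrightarrow> rk v = Suc (rk u) \<Longrightarrow> R u v"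
    and "\<And>u v. u \<in> s \<Longrightarrow> v \<in> s \<Longrightarrow> rk u = rk v \<Longrightarrow> u = v"
    and "\<And>u. u \<in> s \<Longrightarrow> rk u \<le> n"
proof -
  show bij: "bij_betw rk s {..n}" using assms by (simp add: graded_chains_def)
  show "finite s" "card s = n + 1" using bij_betw_finite[OF bij] bij_betw_same_card[OF bij] by auto
qed (use assms in \<open>auto simp: graded_chains_def bij_betw_def inj_on_def\<close>)

lemma graded_chains_vertex:
  assumes "s \<in> graded_chains n P rk R" "i \<le> n"
  obtains u where "u \<in> s" "rk u = i"
  using graded_chainsD(2)[OF assms(1)] assms(2) by (metis atMost_iff bij_betw_imp_surj_on imageE)

lemma graded_chains_rtranclp:
  assumes chain: "s \<in> graded_chains n P rk R" and "u \<in> s" "w \<in> s" "rk u \<le> rk w"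
  shows "R\<^sup>*\<^sup>* u w"
proof -
  have "R\<^sup>*\<^sup>* u w" if "w \<in> s" "rk w = rk u + k" for w k
    using that
  proof (induction k arbitrary: w)
    case 0
    then have "w = u" using graded_chainsD(6)[OF chain] \<open>u \<in> s\<close> by simp
    then show ?case by simp
  next
    case (Suc k)
    then have "rk u + k \<le> n" using graded_chainsD(7)[OF chain] Suc_leD by fastforce
    then obtain v where predecessor: "v \<in> s" "rk v = rk u + k"
      by (rule graded_chains_vertex[OF chain])
    then have "R v w" using Suc.prems graded_chainsD(5)[OF chain, of v w] by simp
    then show ?case using Suc.IH[OF predecessor] by simp
  qed
  then show ?thesis using assms(3,4) le_Suc_ex by blast
qed

lemma graded_chains_image:
  assumes chain: "s \<in> graded_chains n P rk R" and "inj_on f P" "f ` P \<subseteq> P"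
    and "\<And>v. v \<in> P \<Longrightarrow> rk (f v) = rk v"
    and "\<And>u v. u \<in> P \<Longrightarrow> v \<in> P \<Longrightarrow> R u v \<Longrightarrow> R (f u) (f v)"
  shows "f ` s \<in> graded_chains n P rk R"
proof -
  note in_P = graded_chainsD(1)[OF chain]
  have "bij_betw (rk \<circ> f) s {..n}"
    using graded_chainsD(2)[OF chain] bij_betw_cong[of s "rk \<circ> f" rk] assms(4) in_P by auto
  then have "bij_betw rk (f ` s) {..n}"
    using inj_on_subset[OF assms(2) in_P] by (metis bij_betw_comp_iff bij_betw_imageI)
  moreover have "R (f u) (f v)" if "u \<in> s" "v \<in> s" "rk (f v) = Suc (rk (f u))" for u v
    using that assms(4,5) in_P graded_chainsD(5)[OF chain] by (metis subsetD)
  moreover have "f ` s \<subseteq> P" using in_P assms(3) by blast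
  ultimately show ?thesis by (auto simp: graded_chains_def)
qed

locale even_graded_relation = free_klein_four_action P g h
  for P :: "'v set" and g h :: "'v \<Rightarrow> 'v" +
  fixes n :: nat and rk :: "'v \<Rightarrow> nat" and R :: "'v \<Rightarrow> 'v \<Rightarrow> bool"
  assumes dim_pos: "0 < n"
    and finite_P: "finite P"
    and rk_g: "v \<in> P \<Longrightarrow> rk (g v) = rk v" and rk_h: "v \<in> P \<Longrightarrow> rk (h v) = rk v"
    and R_g: "u \<in> P \<Longrightarrow> v \<in> P \<Longrightarrow> R u v \<Longrightarrow> R (g u) (g v)"
    and R_h: "u \<in> P \<Longrightarrow> v \<in> P \<Longrightarrow> R u v \<Longrightarrow> R (h u) (h v)"
    and even_below: "w \<in> P \<Longrightarrow> rk w = 1 \<Longrightarrow> even (card {u\<in>P. rk u = 0 \<and> R u w})"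
    and even_between: "u \<in> P \<Longrightarrow> w \<in> P \<Longrightarrow> v \<in> P \<Longrightarrow> rk v = Suc (rk u) \<Longrightarrow> rk w = Suc (rk v) \<Longrightarrow>
      R u v \<Longrightarrow> R v w \<Longrightarrow> even (card {v\<in>P. rk v = Suc (rk u) \<and> R u v \<and> R v w})"
    and even_above: "u \<in> P \<Longrightarrow> w \<in> P \<Longrightarrow> Suc (rk u) = n \<Longrightarrow> rk w = n \<Longrightarrow> R u w \<Longrightarrow>
      even (card {w\<in>P. rk w = n \<and> R u w})"
begin

definition replacements :: "'v set \<Rightarrow> 'v \<Rightarrow> 'v set" where
  "replacements s v = {v'\<in>P. rk v' = rk v \<and> (\<forall>u\<in>s. rk v = Suc (rk u) \<longrightarrow> R u v') \<and>
     (\<forall>w\<in>s. rk w = Suc (rk v) \<longrightarrow> R v' w)}"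

lemma replacement_notin:
  assumes "s \<in> graded_chains n P rk R" "v \<in> s" "v' \<in> replacements s v"
  shows "v' \<notin> s - {v}"
  using assms graded_chainsD(6)[OF assms(1)] by (auto simp: replacements_def)

lemma replace_in_graded_chains:
  assumes chain: "s \<in> graded_chains n P rk R" and member: "v \<in> s"
    and replacement: "v' \<in> replacements s v"
  shows "insert v' (s - {v}) \<in> graded_chains n P rk R"
proof -
  note bij = graded_chainsD(2)[OF chain]
  have same_rk: "rk v' = rk v" using replacement by (simp add: replacements_def)
  have "rk v \<notin> rk ` (s - {v})" using graded_chainsD(6)[OF chain] member by blast
  then have "inj_on rk (insert v' (s - {v}))"
    using bij same_rk by (auto simp: bij_betw_def intro: inj_on_subset)
  moreover have "rk ` insert v' (s - {v}) = rk ` s" using member same_rk by auto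
  ultimately have "bij_betw rk (insert v' (s - {v})) {..n}" using bij by (auto simp: bij_betw_def)
  then show ?thesis
    using replacement same_rk graded_chainsD(1,5)[OF chain] member
    by (auto simp: graded_chains_def replacements_def)
qed

lemma graded_chains_containing_facet:
  assumes chain: "s \<in> graded_chains n P rk R" and member: "v \<in> s"
  shows "{t\<in>graded_chains n P rk R. s - {v} \<subseteq> t} = (\<lambda>v'. insert v' (s - {v})) ` replacements s v"
proof (intro equalityI subsetI)
  fix t assume "t \<in> {t\<in>graded_chains n P rk R. s - {v} \<subseteq> t}"
  then have other_chain: "t \<in> graded_chains n P rk R" "s - {v} \<subseteq> t" by auto
  obtain v' where opposite: "v' \<in> t" "rk v' = rk v"
    using graded_chains_vertex[OF other_chain(1)] graded_chainsD(7)[OF chain member] by metis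
  have "R u v'" if "u \<in> s" "rk v = Suc (rk u)" for u
    using that other_chain opposite graded_chainsD(5)[OF other_chain(1), of u v'] by auto
  moreover have "R v' w" if "w \<in> s" "rk w = Suc (rk v)" for w
    using that other_chain opposite graded_chainsD(5)[OF other_chain(1), of v' w] by auto
  ultimately have replacement: "v' \<in> replacements s v"
    using opposite graded_chainsD(1)[OF other_chain(1)] by (auto simp: replacements_def)
  have "insert v' (s - {v}) = t"
  proof (rule card_subset_eq)
    show "card (insert v' (s - {v})) = card t"
      using replacement_notin[OF chain member replacement] graded_chainsD(3,4)[OF chain]
        graded_chainsD(4)[OF other_chain(1)] member
      by (simp add: card.insert_remove)
  qed (use opposite other_chain graded_chainsD(3) in auto)
  then show "t \<in> (\<lambda>v'. insert v' (s - {v})) ` replacements s v" using replacement by blast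
qed (use replace_in_graded_chains[OF chain member] in auto)

lemma even_card_replacements:
  assumes chain: "s \<in> graded_chains n P rk R" and member: "v \<in> s"
  shows "even (card (replacements s v))"
proof -
  note in_P = subsetD[OF graded_chainsD(1)[OF chain]] and uniq = graded_chainsD(6)[OF chain]
    and step = graded_chainsD(5)[OF chain]
  have pred: "(\<forall>x\<in>s. rk v = Suc (rk x) \<longrightarrow> Q x) \<longleftrightarrow> Q u" if "u \<in> s" "rk v = Suc (rk u)" for u Q
    using that uniq by (metis Suc_inject)
  have succ: "(\<forall>x\<in>s. rk x = Suc (rk v) \<longrightarrow> Q x) \<longleftrightarrow> Q w" if "w \<in> s" "rk w = Suc (rk v)" for w Q
    using that uniq by metis
  consider "rk v = 0" | "0 < rk v" "rk v = n" | "0 < rk v" "rk v < n"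
    using graded_chainsD(7)[OF chain member] by linarith
  then show ?thesis
  proof cases
    case 1
    obtain w where above: "w \<in> s" "rk w = Suc (rk v)"
      using graded_chains_vertex[OF chain, of 1] dim_pos 1 by (metis One_nat_def Suc_leI)
    have "replacements s v = {u\<in>P. rk u = 0 \<and> R u w}"
      unfolding replacements_def succ[OF above] using 1 by auto
    then show ?thesis using even_below[of w] above in_P 1 by simp
  next
    case 2
    obtain u where below: "u \<in> s" "rk v = Suc (rk u)"
      using graded_chains_vertex[OF chain, of "n - 1"] 2 by (metis Suc_diff_1 diff_le_self)
    have "rk w \<noteq> Suc (rk v)" if "w \<in> s" for w
      using graded_chainsD(7)[OF chain that] 2 by simp
    then have "replacements s v = {w\<in>P. rk w = n \<and> R u w}"
      unfolding replacements_def pred[OF below] using 2(2) by auto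
    then show ?thesis using even_above[of u v] below member in_P step 2 by simp
  next
    case 3
    obtain u where below: "u \<in> s" "rk v = Suc (rk u)"
      using graded_chains_vertex[OF chain, of "rk v - 1"] 3
      by (metis Suc_diff_1 diff_le_self less_imp_le order_trans)
    obtain w where above: "w \<in> s" "rk w = Suc (rk v)"
      using graded_chains_vertex[OF chain, of "Suc (rk v)"] 3 by (metis Suc_leI)
    have "replacements s v = {v'\<in>P. rk v' = Suc (rk u) \<and> R u v' \<and> R v' w}"
      unfolding replacements_def pred[OF below] succ[OF above] using below(2) by auto
    then show ?thesis using even_between[of u w v] below above member in_P step by simp
  qed
qed

lemma even_card_graded_chains_facet:
  assumes chain: "s \<in> graded_chains n P rk R" and member: "v \<in> s"
  shows "even (card {t\<in>graded_chains n P rk R. s - {v} \<subseteq> t})"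
proof -
  have "inj_on (\<lambda>v'. insert v' (s - {v})) (replacements s v)"
    using replacement_notin[OF chain member] by (intro inj_onI) (metis insert_iff)
  then show ?thesis
    using even_card_replacements[OF chain member]
    by (simp add: graded_chains_containing_facet[OF chain member] card_image)
qed

lemma graded_chains_verts: "v \<in> \<Union>(graded_chains n P rk R) \<Longrightarrow> v \<in> P"
  using graded_chainsD(1) by blast

theorem graded_complex_graded_chains: "graded_complex (graded_chains n P rk R) g h n rk"
proof
  let ?F = "graded_chains n P rk R"
  show g_chain: "g ` s \<in> ?F" if "s \<in> ?F" for s
    using that inj_on_g g_closed rk_g R_g by (intro graded_chains_image) auto
  show h_chain: "h ` s \<in> ?F" if "s \<in> ?F" for s
    using that inj_on_h h_closed rk_h R_h by (intro graded_chains_image) auto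
  show "g v \<in> \<Union>?F" "h v \<in> \<Union>?F" if "v \<in> \<Union>?F" for v
    using that g_chain h_chain by blast+
  have "?F \<subseteq> Pow P" using graded_chainsD(1) by blast
  then show "finite ?F" using finite_P finite_subset by blast
qed (use dim_pos even_card_graded_chains_facet graded_chainsD(2)
    in \<open>simp_all add: graded_chains_verts g_g h_h h_g g_free h_free gh_free rk_g rk_h del: Union_iff\<close>)

end

section \<open>Barycentric subdivision\<close>

definition faces :: "'v set set \<Rightarrow> 'v set set" where
  "faces F = {X. X \<noteq> {} \<and> (\<exists>s\<in>F. X \<subseteq> s)}"

definition face_dim :: "'v set \<Rightarrow> nat" where
  "face_dim X = card X - 1"

definition subdivision :: "nat \<Rightarrow> 'v set set \<Rightarrow> 'v set set set" where
  "subdivision n F = graded_chains n (faces F) face_dim (\<subseteq>)"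

lemma even_card_sets_between:
  assumes "finite Y" "X \<subseteq> Y" "card Y = card X + 2"
  shows "even (card {Z. X \<subseteq> Z \<and> Z \<subseteq> Y \<and> card Z = card X + 1})"
proof -
  have fin: "finite X" using assms finite_subset by blast
  have "card (Y - X) = 2" using assms by (simp add: card_Diff_subset fin)
  then obtain x y where missing: "Y - X = {x, y}" "x \<noteq> y" by (auto simp: card_2_iff)
  have notin: "x \<notin> X" "y \<notin> X" using missing(1) by auto
  have "{Z. X \<subseteq> Z \<and> Z \<subseteq> Y \<and> card Z = card X + 1} = {insert x X, insert y X}"
  proof (intro equalityI subsetI)
    fix Z assume "Z \<in> {Z. X \<subseteq> Z \<and> Z \<subseteq> Y \<and> card Z = card X + 1}"
    then have between: "X \<subseteq> Z" "Z \<subseteq> Y" "card Z = card X + 1" by auto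
    then have "card (Z - X) = 1" by (simp add: card_Diff_subset fin)
    then obtain a where "Z - X = {a}" by (auto simp: card_1_singleton_iff)
    then have "Z = insert a X" "a \<in> {x, y}" using between missing by auto
    then show "Z \<in> {insert x X, insert y X}" by blast
  qed (use missing assms(2) fin notin in auto)
  moreover have "insert x X \<noteq> insert y X" using missing(2) notin by blast
  ultimately show ?thesis by simp
qed

context graded_complex
begin

lemma finite_face: "X \<in> faces F \<Longrightarrow> finite X"
  using finite_simplex finite_subset by (auto simp: faces_def)

lemma card_face: "X \<in> faces F \<Longrightarrow> card X = face_dim X + 1"
  using finite_face by (auto simp: faces_def face_dim_def card_gt_0_iff Suc_leI)

lemma face_dim_eq_iff: "X \<in> faces F \<Longrightarrow> face_dim X = k \<longleftrightarrow> card X = k + 1"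
  using card_face by auto

lemma face_subset: "Y \<in> faces F \<Longrightarrow> X \<subseteq> Y \<Longrightarrow> 0 < card X \<Longrightarrow> X \<in> faces F"
  by (auto simp: faces_def)

lemma face_of_full_dim:
  assumes "X \<in> faces F" "face_dim X = n"
  shows "X \<in> F"
proof -
  obtain s where carrier: "s \<in> F" "X \<subseteq> s" using assms(1) by (auto simp: faces_def)
  then have "X = s"
    using card_face[OF assms(1)] assms(2) card_simplex finite_simplex by (intro card_subset_eq) auto
  then show ?thesis using carrier by simp
qed

lemma simplex_face: "s \<in> F \<Longrightarrow> s \<in> faces F" and simplex_face_dim: "s \<in> F \<Longrightarrow> face_dim s = n"
  using card_simplex[of s] by (auto simp: faces_def face_dim_def)

lemma face_subset_verts: "X \<in> faces F \<Longrightarrow> X \<subseteq> \<Union>F"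
  by (auto simp: faces_def)

lemma image_face_ne:
  assumes face: "X \<in> faces F" and rk_invariant: "\<And>v. v \<in> \<Union>F \<Longrightarrow> rk (f v) = rk v"
    and free: "\<And>v. v \<in> \<Union>F \<Longrightarrow> f v \<noteq> v"
  shows "f ` X \<noteq> X"
proof
  assume fixed: "f ` X = X"
  obtain s v where carrier: "s \<in> F" "X \<subseteq> s" "v \<in> X" using face by (auto simp: faces_def)
  then have "f v \<in> s" "v \<in> s" using fixed by blast+
  then show False using rk_inj[OF carrier(1)] rk_invariant free carrier(1) by blast
qed

lemma free_klein_four_action_faces: "free_klein_four_action (faces F) ((`) g) ((`) h)"
proof
  fix X assume face: "X \<in> faces F"
  note sub = subsetD[OF face_subset_verts[OF face]]
  show "g ` X \<in> faces F" "h ` X \<in> faces F"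
    using face g_simplex h_simplex by (auto simp: faces_def) (metis image_mono)+
  show "g ` g ` X = X" "h ` h ` X = X" "h ` g ` X = g ` h ` X"
    by (simp_all add: image_image g_g[OF sub] h_h[OF sub] h_g[OF sub] cong: image_cong_simp)
  show "g ` X \<noteq> X" "h ` X \<noteq> X"
    using image_face_ne[OF face] rk_g rk_h g_free h_free by blast+
  have "rk (g (h v)) = rk v" if "v \<in> \<Union>F" for v
    using rk_g[OF h_closed[OF that]] rk_h[OF that] by simp
  then show "g ` h ` X \<noteq> X"
    unfolding image_image using image_face_ne[OF face, of "\<lambda>v. g (h v)"] gh_free by blast
qed

lemma even_graded_relation_faces:
  "even_graded_relation (faces F) ((`) g) ((`) h) n face_dim (\<subseteq>)"
proof -
  interpret faces: free_klein_four_action "faces F" "(`) g" "(`) h"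
    by (rule free_klein_four_action_faces)
  show ?thesis
  proof
    show "finite (faces F)"
      using finite_verts face_subset_verts by (auto intro: finite_subset[of _ "Pow (\<Union>F)"])
    show "face_dim (g ` X) = face_dim X" "face_dim (h ` X) = face_dim X" if "X \<in> faces F" for X
      using face_subset_verts[OF that] inj_on_g inj_on_h
      by (simp_all add: face_dim_def card_image inj_on_subset)
    show "even (card {X\<in>faces F. face_dim X = 0 \<and> X \<subseteq> Y})"
      if edge: "Y \<in> faces F" "face_dim Y = 1" for Y
    proof -
      have "{X\<in>faces F. face_dim X = 0 \<and> X \<subseteq> Y} = {X. {} \<subseteq> X \<and> X \<subseteq> Y \<and> card X = card {} + 1}"
        using face_subset[OF edge(1)] by (auto simp: face_dim_eq_iff)
      then show ?thesis
        using even_card_sets_between[of Y "{}"] card_face finite_face edge by simp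
    qed
    show "even (card {Z\<in>faces F. face_dim Z = Suc (face_dim X) \<and> X \<subseteq> Z \<and> Z \<subseteq> Y})"
      if nested: "X \<in> faces F" "Y \<in> faces F" "Z \<in> faces F" "face_dim Z = Suc (face_dim X)"
        "face_dim Y = Suc (face_dim Z)" "X \<subseteq> Z" "Z \<subseteq> Y" for X Y Z
    proof -
      have "{Z\<in>faces F. face_dim Z = Suc (face_dim X) \<and> X \<subseteq> Z \<and> Z \<subseteq> Y} =
          {Z. X \<subseteq> Z \<and> Z \<subseteq> Y \<and> card Z = card X + 1}"
        using face_subset[OF nested(2)] card_face[OF nested(1)] by (auto simp: face_dim_eq_iff)
      then show ?thesis
        using even_card_sets_between[of Y X] card_face finite_face nested by auto
    qed
    show "even (card {Y\<in>faces F. face_dim Y = n \<and> X \<subseteq> Y})"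
      if nested: "X \<in> faces F" "Y \<in> faces F" "Suc (face_dim X) = n" "face_dim Y = n" "X \<subseteq> Y" for X Y
    proof -
      have "card (Y - X) = 1"
        using nested card_face finite_face by (simp add: card_Diff_subset)
      then obtain v where "Y - X = {v}" by (auto simp: card_1_singleton_iff)
      then have "X = Y - {v}" "v \<in> Y" using nested(5) by auto
      moreover have "{Y\<in>faces F. face_dim Y = n \<and> X \<subseteq> Y} = {t\<in>F. X \<subseteq> t}"
        using face_of_full_dim simplex_face simplex_face_dim by blast
      ultimately show ?thesis using even_facet[OF face_of_full_dim[OF nested(2,4)]] by simp
    qed
  qed (use dim_pos in auto)
qed

lemma graded_complex_subdivision: "graded_complex (subdivision n F) ((`) g) ((`) h) n face_dim"
  unfolding subdivision_def
  by (rule even_graded_relation.graded_complex_graded_chains[OF even_graded_relation_faces])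

lemma subdivision_subset_faces: "\<sigma> \<in> subdivision n F \<Longrightarrow> \<sigma> \<subseteq> faces F"
  unfolding subdivision_def by (rule graded_chainsD(1))

lemma subdivision_nested:
  assumes "\<sigma> \<in> subdivision n F" "X \<in> \<sigma>" "Y \<in> \<sigma>" "face_dim X \<le> face_dim Y"
  shows "X \<subseteq> Y"
  using graded_chains_rtranclp[OF assms(1)[unfolded subdivision_def] assms(2-4)]
  by (induction rule: rtranclp_induct) auto

lemma subdivision_carrier:
  assumes "\<sigma> \<in> subdivision n F"
  obtains s where "s \<in> F" "\<And>X. X \<in> \<sigma> \<Longrightarrow> X \<subseteq> s"
proof -
  note chain = assms[unfolded subdivision_def]
  obtain s where top: "s \<in> \<sigma>" "face_dim s = n" by (rule graded_chains_vertex[OF chain order_refl])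
  show thesis
  proof
    show "s \<in> F" using face_of_full_dim subdivision_subset_faces[OF assms] top by blast
    show "X \<subseteq> s" if "X \<in> \<sigma>" for X
      using subdivision_nested[OF assms that top(1)] graded_chainsD(7)[OF chain that] top(2) by simp
  qed
qed

definition lowest_vertex :: "'v set \<Rightarrow> 'v" where
  "lowest_vertex X = arg_min_on rk X"

lemma lowest_vertex_in: "X \<in> faces F \<Longrightarrow> lowest_vertex X \<in> X"
  and rk_lowest_vertex_le: "X \<in> faces F \<Longrightarrow> x \<in> X \<Longrightarrow> rk (lowest_vertex X) \<le> rk x"
  using arg_min_if_finite[OF finite_face, of X rk] unfolding lowest_vertex_def
  by (auto simp: faces_def not_less)

lemma lowest_vertex_eqI:
  assumes face: "X \<in> faces F" and lowest: "x \<in> X" "\<And>y. y \<in> X \<Longrightarrow> rk x \<le> rk y"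
  shows "lowest_vertex X = x"
proof -
  obtain s where "s \<in> F" "X \<subseteq> s" using face by (auto simp: faces_def)
  moreover have "rk (lowest_vertex X) = rk x"
    using lowest_vertex_in[OF face] rk_lowest_vertex_le[OF face] lowest by (simp add: order_antisym)
  ultimately show ?thesis using rk_inj lowest_vertex_in[OF face] lowest(1) by blast
qed

lemma lowest_vertex_g: "X \<in> faces F \<Longrightarrow> lowest_vertex (g ` X) = g (lowest_vertex X)"
  and lowest_vertex_h: "X \<in> faces F \<Longrightarrow> lowest_vertex (h ` X) = h (lowest_vertex X)"
proof -
  interpret faces: free_klein_four_action "faces F" "(`) g" "(`) h"
    by (rule free_klein_four_action_faces)
  assume face: "X \<in> faces F"
  note sub = subsetD[OF face_subset_verts[OF face]]
  show "lowest_vertex (g ` X) = g (lowest_vertex X)" "lowest_vertex (h ` X) = h (lowest_vertex X)"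
    using lowest_vertex_in[OF face] rk_lowest_vertex_le[OF face]
    by (auto intro!: lowest_vertex_eqI faces.g_closed faces.h_closed face
      simp: rk_g[OF sub] rk_h[OF sub])
qed

definition upper_face :: "'v set \<Rightarrow> 'v \<Rightarrow> 'v set" where
  "upper_face s x = {y\<in>s. rk x \<le> rk y}"

definition upper_flag :: "'v set \<Rightarrow> 'v set set" where
  "upper_flag s = upper_face s ` s"

lemma card_upper_face:
  assumes "s \<in> F" "x \<in> s"
  shows "card (upper_face s x) = n - rk x + 1"
proof -
  note bij = rk_bij[OF assms(1)]
  have "bij_betw rk (upper_face s x) {rk x..n}"
    using bij by (auto simp: bij_betw_def upper_face_def inj_on_def image_iff)
      (metis atMost_iff imageE)
  moreover have "rk x \<le> n" using bij assms(2) by (auto simp: bij_betw_def)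
  ultimately show ?thesis using bij_betw_same_card by fastforce
qed

lemma upper_face:
  assumes "s \<in> F" "x \<in> s"
  shows "upper_face s x \<in> faces F" "face_dim (upper_face s x) = n - rk x"
    "lowest_vertex (upper_face s x) = x"
proof -
  show face: "upper_face s x \<in> faces F" using assms by (auto simp: faces_def upper_face_def)
  show "face_dim (upper_face s x) = n - rk x"
    using card_upper_face[OF assms] by (simp add: face_dim_def)
  show "lowest_vertex (upper_face s x) = x"
    using assms by (intro lowest_vertex_eqI[OF face]) (auto simp: upper_face_def)
qed

lemma lowest_vertex_upper_flag: "s \<in> F \<Longrightarrow> lowest_vertex ` upper_flag s = s"
  using upper_face(3) by (force simp: upper_flag_def)

lemma upper_flag_in_subdivision:
  assumes simplex: "s \<in> F"
  shows "upper_flag s \<in> subdivision n F"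
proof -
  note bij = rk_bij[OF simplex]
  have "face_dim ` upper_flag s = (\<lambda>j. n - j) ` rk ` s"
    unfolding upper_flag_def image_image using upper_face(2)[OF simplex] by (intro image_cong) auto
  also have "rk ` s = {..n}" using bij by (simp add: bij_betw_def)
  also have "(\<lambda>j. n - j) ` {..n} = {..n}"
    by (auto simp: image_iff) (metis atMost_iff diff_diff_cancel diff_le_self)
  finally have image: "face_dim ` upper_flag s = {..n}" .
  have "card (upper_flag s) \<le> card (face_dim ` upper_flag s)"
    using card_image_le[OF finite_simplex[OF simplex], of "upper_face s"] card_simplex[OF simplex]
    by (simp add: upper_flag_def[symmetric] image)
  then have "bij_betw face_dim (upper_flag s) {..n}"
    unfolding bij_betw_def using image finite_simplex[OF simplex]
    by (metis card_image_le eq_card_imp_inj_on finite_imageI le_antisym upper_flag_def)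
  moreover have "X \<subseteq> Y"
    if consecutive: "X \<in> upper_flag s" "Y \<in> upper_flag s" "face_dim Y = Suc (face_dim X)" for X Y
  proof -
    obtain x y where "x \<in> s" "y \<in> s" "X = upper_face s x" "Y = upper_face s y"
      using consecutive by (auto simp: upper_flag_def)
    moreover from this have "rk y \<le> rk x" using consecutive(3) upper_face(2)[OF simplex] by simp
    ultimately show ?thesis by (auto simp: upper_face_def)
  qed
  moreover have "upper_flag s \<subseteq> faces F"
    using upper_face(1)[OF simplex] by (auto simp: upper_flag_def)
  ultimately show ?thesis by (auto simp: subdivision_def graded_chains_def)
qed

lemma face_subset_upper_face:
  "X \<in> faces F \<Longrightarrow> X \<subseteq> s \<Longrightarrow> X \<subseteq> upper_face s (lowest_vertex X)"
  using rk_lowest_vertex_le by (auto simp: upper_face_def)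

lemma rk_lowest_vertex_add_face_dim_le:
  assumes simplex: "s \<in> F" and face: "X \<in> faces F" "X \<subseteq> s"
  shows "rk (lowest_vertex X) + face_dim X \<le> n"
proof -
  have low: "lowest_vertex X \<in> s" using lowest_vertex_in face by blast
  have "card X \<le> card (upper_face s (lowest_vertex X))"
    using face_subset_upper_face[OF face] finite_simplex[OF simplex]
    by (intro card_mono) (auto simp: upper_face_def)
  moreover have "rk (lowest_vertex X) \<le> n" using rk_bij[OF simplex] low by (auto simp: bij_betw_def)
  ultimately show ?thesis using card_upper_face[OF simplex low] card_face[OF face(1)] by simp
qed

text \<open>If the lowest vertices exhaust \<open>s\<close>, then summing the inequality above over the chain forces
  equality for every member of the chain.\<close>

lemma upper_flag_unique:
  assumes flag: "\<sigma> \<in> subdivision n F" and carrier: "s \<in> F" "\<And>X. X \<in> \<sigma> \<Longrightarrow> X \<subseteq> s"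
    and onto: "lowest_vertex ` \<sigma> = s"
  shows "\<sigma> = upper_flag s"
proof -
  note chain = graded_chainsD[OF flag[unfolded subdivision_def]]
  have face: "X \<in> faces F" if "X \<in> \<sigma>" for X using chain(1) that by blast
  have inj: "inj_on lowest_vertex \<sigma>"
    using onto chain(3,4) card_simplex[OF carrier(1)] by (intro eq_card_imp_inj_on) auto
  have "(\<Sum>X\<in>\<sigma>. rk (lowest_vertex X)) = (\<Sum>x\<in>s. rk x)"
    using sum.reindex[OF inj, of rk] onto by simp
  also have "\<dots> = (\<Sum>j\<le>n. j)"
    by (rule sum.reindex_bij_betw[OF rk_bij[OF carrier(1)]])
  finally have "(\<Sum>X\<in>\<sigma>. rk (lowest_vertex X) + face_dim X) = 2 * (\<Sum>j\<le>n. j)"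
    using sum.reindex_bij_betw[OF chain(2), of "\<lambda>j. j"] by (simp add: sum.distrib)
  also have "\<dots> = (\<Sum>X\<in>\<sigma>. n)"
    using gauss_sum_nat[of n] chain(4) by (simp add: atLeast0AtMost[symmetric])
  finally have total: "(\<Sum>X\<in>\<sigma>. rk (lowest_vertex X) + face_dim X) = (\<Sum>X\<in>\<sigma>. n)" .
  have "X = upper_face s (lowest_vertex X)" if member: "X \<in> \<sigma>" for X
  proof (rule card_subset_eq)
    have low: "lowest_vertex X \<in> s" using onto member by blast
    show "finite (upper_face s (lowest_vertex X))"
      using finite_simplex[OF carrier(1)] by (simp add: upper_face_def)
    show "X \<subseteq> upper_face s (lowest_vertex X)"
      using face_subset_upper_face face carrier(2) member by blast
    have "rk (lowest_vertex X) + face_dim X = n"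
      using sum_mono_inv[OF total _ member chain(3)] face carrier(2)
        rk_lowest_vertex_add_face_dim_le[OF carrier(1)]
      by blast
    then show "card X = card (upper_face s (lowest_vertex X))"
      using card_upper_face[OF carrier(1) low] card_face[OF face[OF member]] by simp
  qed
  then have "\<sigma> = upper_face s ` lowest_vertex ` \<sigma>" by force
  then show ?thesis by (simp add: upper_flag_def onto)
qed

end

context essential_labelling
begin

lemma carrier_covered_if_balanced:
  assumes "\<sigma> \<in> subdivision n F" "\<tau> \<subseteq> \<sigma>" "s \<in> F" "\<And>X. X \<in> \<sigma> \<Longrightarrow> X \<subseteq> s"
    and bal: "balanced z (lowest_vertex ` \<tau>)"
  shows "lowest_vertex ` \<tau> = s"
proof (rule ccontr)
  assume "lowest_vertex ` \<tau> \<noteq> s"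
  moreover have "lowest_vertex ` \<tau> \<subseteq> s"
    using assms(1,2,4) lowest_vertex_in subdivision_subset_faces by blast
  ultimately obtain v where "v \<in> s" "lowest_vertex ` \<tau> \<subseteq> s - {v}" by blast
  then show False
    using generic_z \<open>s \<in> F\<close> balanced_mono[OF bal] unfolding generic_labelling_def by blast
qed

lemma generic_labelling_subdivision:
  "generic_labelling (subdivision n F) (\<lambda>X. z (lowest_vertex X))"
  unfolding generic_labelling_def
proof (intro ballI notI)
  fix \<sigma> X assume flag: "\<sigma> \<in> subdivision n F" "X \<in> \<sigma>"
    and bal: "balanced (\<lambda>X. z (lowest_vertex X)) (\<sigma> - {X})"
  obtain s where carrier: "s \<in> F" "\<And>Y. Y \<in> \<sigma> \<Longrightarrow> Y \<subseteq> s" using subdivision_carrier[OF flag(1)] by blast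
  have "balanced z (lowest_vertex ` (\<sigma> - {X}))" using bal by (simp add: image_image)
  then have "lowest_vertex ` (\<sigma> - {X}) = s"
    by (intro carrier_covered_if_balanced[OF flag(1) _ carrier]) auto
  then have "card s \<le> card (\<sigma> - {X})"
    using graded_chainsD(3)[OF flag(1)[unfolded subdivision_def]] card_image_le
    by (metis finite_Diff)
  then show False
    using graded_chainsD(3,4)[OF flag(1)[unfolded subdivision_def]] flag(2)
      card_simplex[OF carrier(1)] by simp
qed

lemma num_balanced_subdivision:
  "num_balanced (subdivision n F) (\<lambda>X. z (lowest_vertex X)) = num_balanced F z"
proof -
  have iff: "balanced (\<lambda>X. z (lowest_vertex X)) \<sigma> \<longleftrightarrow> balanced z (lowest_vertex ` \<sigma>)" for \<sigma>
    by (simp add: image_image)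
  have "{\<sigma>\<in>subdivision n F. balanced (\<lambda>X. z (lowest_vertex X)) \<sigma>} =
      upper_flag ` {s\<in>F. balanced z s}"
    unfolding iff
  proof (intro equalityI subsetI)
    fix \<sigma> assume "\<sigma> \<in> {\<sigma>\<in>subdivision n F. balanced z (lowest_vertex ` \<sigma>)}"
    then have flag: "\<sigma> \<in> subdivision n F" "balanced z (lowest_vertex ` \<sigma>)" by auto
    obtain s where carrier: "s \<in> F" "\<And>X. X \<in> \<sigma> \<Longrightarrow> X \<subseteq> s"
      using subdivision_carrier[OF flag(1)] by blast
    have "lowest_vertex ` \<sigma> = s"
      using carrier_covered_if_balanced[OF flag(1) order_refl carrier flag(2)] .
    then show "\<sigma> \<in> upper_flag ` {s\<in>F. balanced z s}"
      using upper_flag_unique[OF flag(1) carrier] carrier(1) flag(2) by blast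
  qed (auto simp: lowest_vertex_upper_flag upper_flag_in_subdivision)
  moreover have "inj_on upper_flag {s\<in>F. balanced z s}"
    using lowest_vertex_upper_flag by (metis (no_types, lifting) inj_onI mem_Collect_eq)
  ultimately show ?thesis unfolding num_balanced_def by (simp add: card_image)
qed

theorem essential_labelling_subdivision:
  "essential_labelling (subdivision n F) ((`) g) ((`) h) n face_dim W (\<lambda>X. z (lowest_vertex X))"
proof -
  have verts_are_faces: "X \<in> faces F" if "X \<in> \<Union>(subdivision n F)" for X
    using that subdivision_subset_faces by blast
  have lowest_in_verts: "lowest_vertex X \<in> \<Union>F" if "X \<in> faces F" for X
    using that lowest_vertex_in face_subset_verts by blast
  show ?thesis
  proof (intro essential_labelling.intro essential_labelling_axioms.intro)
    show "odd_labelling (subdivision n F) ((`) g) ((`) h) (\<lambda>X. z (lowest_vertex X))"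
      unfolding odd_labelling_def
    proof
      fix X assume "X \<in> \<Union>(subdivision n F)"
      then have is_face: "X \<in> faces F" by (rule verts_are_faces)
      show "z (lowest_vertex (g ` X)) = - z (lowest_vertex X) \<and>
          z (lowest_vertex (h ` X)) = - z (lowest_vertex X)"
        unfolding lowest_vertex_g[OF is_face] lowest_vertex_h[OF is_face]
        using odd_labellingD[OF odd_z lowest_in_verts[OF is_face]] ..
    qed
    show "(\<lambda>X. z (lowest_vertex X)) ` \<Union>(subdivision n F) \<subseteq> W"
      using z_subset lowest_in_verts[OF verts_are_faces]
      by (intro image_subsetI) (metis image_subset_iff)
    show "\<not> 8 dvd num_balanced (subdivision n F) (\<lambda>X. z (lowest_vertex X))"
      using not_8_dvd by (simp add: num_balanced_subdivision)
  qed (fact graded_complex_subdivision subspace_W dim_W generic_labelling_subdivision)+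
qed

end

section \<open>Renaming vertices\<close>

context graded_complex
begin

lemma graded_complex_rename:
  fixes e :: "'v \<Rightarrow> 'u"
  assumes inj: "inj_on e (\<Union>F)"
  defines "d \<equiv> inv_into (\<Union>F) e"
  shows "graded_complex ((`) e ` F) (\<lambda>u. e (g (d u))) (\<lambda>u. e (h (d u))) n (\<lambda>u. rk (d u))"
proof
  have decode_encode: "d (e v) = v" if "v \<in> \<Union>F" for v using that inj by (simp add: d_def)
  have decode_image: "(\<lambda>u. e (f (d u))) ` e ` s = e ` f ` s" if "s \<in> F" for s and f :: "'v \<Rightarrow> 'v"
    by (simp add: image_image decode_encode[OF UnionI[OF that]] cong: image_cong_simp)
  show "finite ((`) e ` F)" using finite_complex by simp
  show "bij_betw (\<lambda>u. rk (d u)) s {..n}" if renamed: "s \<in> (`) e ` F" for s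
  proof -
    obtain t where original: "t \<in> F" "s = e ` t" using renamed by blast
    have "bij_betw d (e ` t) t"
      by (rule bij_betw_byWitness[of _ e]) (auto simp: decode_encode[OF UnionI[OF original(1)]])
    then show ?thesis
      using bij_betw_trans[OF _ rk_bij[OF original(1)]] original(2) by (simp add: o_def)
  qed
  show "even (card {t\<in>(`) e ` F. s - {v} \<subseteq> t})" if renamed: "s \<in> (`) e ` F" "v \<in> s" for s v
  proof -
    obtain t a where original: "t \<in> F" "a \<in> t" "s = e ` t" "v = e a" using renamed by blast
    have sub: "e ` t - {e a} \<subseteq> e ` t' \<longleftrightarrow> t - {a} \<subseteq> t'" if "t' \<in> F" for t'
      using inj_on_image_set_diff[OF inj, of t "{a}"] inj_on_image_subset_iff[OF inj, of "t - {a}" t']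
        original(1,2) that by auto
    have "{t'\<in>(`) e ` F. s - {v} \<subseteq> t'} = (`) e ` {t'\<in>F. t - {a} \<subseteq> t'}"
      using sub by (auto simp: original(3,4))
    moreover have "inj_on ((`) e) {t'\<in>F. t - {a} \<subseteq> t'}"
      using inj_on_image_Pow[OF inj] by (rule inj_on_subset) auto
    ultimately show ?thesis using even_facet[OF original(1,2)] by (simp add: card_image)
  qed
  show "(\<lambda>u. e (g (d u))) ` s \<in> (`) e ` F" "(\<lambda>u. e (h (d u))) ` s \<in> (`) e ` F"
    if "s \<in> (`) e ` F" for s
    using that decode_image g_simplex h_simplex by auto
  fix u assume "u \<in> \<Union>((`) e ` F)"
  then obtain v where vertex: "v \<in> \<Union>F" "u = e v" by blast
  note closed = g_closed[OF vertex(1)] h_closed[OF vertex(1)] g_closed[OF h_closed[OF vertex(1)]]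
  have encode_ne: "e a \<noteq> e v" if "a \<in> \<Union>F" "a \<noteq> v" for a
    using that vertex(1) inj by (auto dest: inj_onD)
  show "e (g (d u)) \<in> \<Union>((`) e ` F)" "e (h (d u)) \<in> \<Union>((`) e ` F)"
    using closed by (auto simp: vertex(2) decode_encode[OF vertex(1)])
  show "e (g (d (e (g (d u))))) = u" "e (h (d (e (h (d u))))) = u"
    "e (h (d (e (g (d u))))) = e (g (d (e (h (d u)))))"
    "rk (d (e (g (d u)))) = rk (d u)" "rk (d (e (h (d u)))) = rk (d u)"
    "e (g (d u)) \<noteq> u" "e (h (d u)) \<noteq> u" "e (g (d (e (h (d u))))) \<noteq> u"
    using encode_ne closed g_free h_free gh_free vertex(1)
    by (simp_all add: vertex(2) decode_encode g_g h_h h_g rk_g rk_h del: Union_iff)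
qed (fact dim_pos)

end

lemma (in essential_labelling) essential_labelling_rename:
  fixes e :: "'v \<Rightarrow> 'u"
  assumes inj: "inj_on e (\<Union>F)"
  defines "d \<equiv> inv_into (\<Union>F) e"
  shows "essential_labelling ((`) e ` F) (\<lambda>u. e (g (d u))) (\<lambda>u. e (h (d u))) n (\<lambda>u. rk (d u)) W
    (\<lambda>u. z (d u))"
proof (intro essential_labelling.intro essential_labelling_axioms.intro)
  have decode_encode: "d (e v) = v" if "v \<in> \<Union>F" for v using that inj by (simp add: d_def)
  have bal: "balanced (\<lambda>u. z (d u)) (e ` X) \<longleftrightarrow> balanced z X" if "X \<subseteq> \<Union>F" for X
  proof -
    have "(\<lambda>u. z (d u)) ` e ` X = z ` X"
      by (simp add: image_image decode_encode[OF subsetD[OF that]] cong: image_cong_simp)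
    then show ?thesis by simp
  qed
  show "odd_labelling ((`) e ` F) (\<lambda>u. e (g (d u))) (\<lambda>u. e (h (d u))) (\<lambda>u. z (d u))"
    unfolding odd_labelling_def
  proof
    fix u assume "u \<in> \<Union>((`) e ` F)"
    then obtain v where "v \<in> \<Union>F" "u = e v" by blast
    then show "z (d (e (g (d u)))) = - z (d u) \<and> z (d (e (h (d u)))) = - z (d u)"
      using odd_labellingD[OF odd_z] g_closed h_closed by (simp add: decode_encode del: Union_iff)
  qed
  show "generic_labelling ((`) e ` F) (\<lambda>u. z (d u))"
    unfolding generic_labelling_def
  proof (intro ballI)
    fix s' u assume "s' \<in> (`) e ` F" "u \<in> s'"
    then obtain s v where original: "s \<in> F" "v \<in> s" "s' - {u} = e ` (s - {v})"
      using inj_on_image_set_diff[OF inj, of _ "{_}"] by blast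
    then show "\<not> balanced (\<lambda>u. z (d u)) (s' - {u})"
      using generic_z bal[of "s - {v}"] by (auto simp: generic_labelling_def)
  qed
  have "(\<lambda>u. z (d u)) ` \<Union>((`) e ` F) = z ` \<Union>F"
    by (simp add: image_image decode_encode image_Union[symmetric] del: Union_iff cong: image_cong_simp)
  then show "(\<lambda>u. z (d u)) ` \<Union>((`) e ` F) \<subseteq> W" using z_subset by simp
  have "{s\<in>(`) e ` F. balanced (\<lambda>u. z (d u)) s} = (`) e ` {s\<in>F. balanced z s}"
    using bal by auto
  moreover have "inj_on ((`) e) {s\<in>F. balanced z s}"
    using inj_on_image_Pow[OF inj] by (rule inj_on_subset) auto
  ultimately show "\<not> 8 dvd num_balanced ((`) e ` F) (\<lambda>u. z (d u))"
    using not_8_dvd by (simp add: num_balanced_def card_image)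
  show "graded_complex ((`) e ` F) (\<lambda>u. e (g (d u))) (\<lambda>u. e (h (d u))) n (\<lambda>u. rk (d u))"
    unfolding d_def by (rule graded_complex_rename[OF inj])
qed (fact subspace_W dim_W)+

section \<open>The staircase triangulation of a product of two cross-polytope boundaries\<close>

text \<open>The pair \<open>(i, \<sigma>)\<close> stands for the vertex \<open>e\<^sub>i\<close> or \<open>- e\<^sub>i\<close> of a cross-polytope,
  according to the sign \<open>\<sigma>\<close>.\<close>

type_synonym cross_vertex = "nat \<times> bool"

definition flip_left :: "cross_vertex \<times> cross_vertex \<Rightarrow> cross_vertex \<times> cross_vertex" where
  "flip_left = apfst (apsnd Not)"

definition flip_right :: "cross_vertex \<times> cross_vertex \<Rightarrow> cross_vertex \<times> cross_vertex" where
  "flip_right = apsnd (apsnd Not)"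

definition staircase_verts :: "nat \<Rightarrow> nat \<Rightarrow> (cross_vertex \<times> cross_vertex) set" where
  "staircase_verts a b = ({..a} \<times> UNIV) \<times> ({..b} \<times> UNIV)"

definition staircase_rk :: "cross_vertex \<times> cross_vertex \<Rightarrow> nat" where
  "staircase_rk v = fst (fst v) + fst (snd v)"

definition staircase_step :: "cross_vertex \<times> cross_vertex \<Rightarrow> cross_vertex \<times> cross_vertex \<Rightarrow> bool" where
  "staircase_step u w \<longleftrightarrow>
     fst (fst w) = Suc (fst (fst u)) \<and> snd w = snd u \<or>
     fst w = fst u \<and> fst (snd w) = Suc (fst (snd u))"

definition staircase :: "nat \<Rightarrow> nat \<Rightarrow> (cross_vertex \<times> cross_vertex) set set" where
  "staircase a b = graded_chains (a + b) (staircase_verts a b) staircase_rk staircase_step"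

lemmas staircase_defs = staircase_verts_def staircase_rk_def staircase_step_def

lemma free_klein_four_action_staircase_verts:
  "free_klein_four_action (staircase_verts a b) flip_left flip_right"
  by standard (auto simp: staircase_verts_def flip_left_def flip_right_def apfst_def apsnd_def)

lemma even_card_range_bool: "inj f \<Longrightarrow> even (card (range (f :: bool \<Rightarrow> 'a)))"
  by (simp add: card_image)

lemma inj_signs: "inj (\<lambda>\<sigma>. ((i, \<sigma>), y))" "inj (\<lambda>\<tau>. (x, (j, \<tau>)))"
  by (simp_all add: inj_def)

lemma even_card_staircase_below:
  assumes "w \<in> staircase_verts a b" "staircase_rk w = 1"
  shows "even (card {u\<in>staircase_verts a b. staircase_rk u = 0 \<and> staircase_step u w})"
proof -
  obtain i \<sigma> j \<tau> where w_eq: "w = ((i, \<sigma>), (j, \<tau>))" by (metis prod.exhaust)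
  then consider "i = 1" "j = 0" | "i = 0" "j = 1"
    using assms(2) by (auto simp: staircase_rk_def add_is_1)
  then show ?thesis
  proof cases
    case 1
    then have "{u\<in>staircase_verts a b. staircase_rk u = 0 \<and> staircase_step u w} =
        range (\<lambda>\<sigma>. ((0, \<sigma>), (0, \<tau>)))"
      by (auto simp: w_eq staircase_defs)
    then show ?thesis using even_card_range_bool[OF inj_signs(1)] by simp
  next
    case 2
    then have "{u\<in>staircase_verts a b. staircase_rk u = 0 \<and> staircase_step u w} =
        range (\<lambda>\<tau>. ((0, \<sigma>), (0, \<tau>)))"
      by (auto simp: w_eq staircase_defs)
    then show ?thesis using even_card_range_bool[OF inj_signs(2)] by simp
  qed
qed

lemma even_card_staircase_between:
  assumes "u \<in> staircase_verts a b" "w \<in> staircase_verts a b"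
    and "staircase_step u v" "staircase_step v w"
  shows "even (card {v\<in>staircase_verts a b.
    staircase_rk v = Suc (staircase_rk u) \<and> staircase_step u v \<and> staircase_step v w})"
    (is "even (card ?V)")
proof -
  obtain i \<sigma> j \<tau> i' \<sigma>' j' \<tau>' where u_eq: "u = ((i, \<sigma>), (j, \<tau>))" and w_eq: "w = ((i', \<sigma>'), (j', \<tau>'))"
    by (metis prod.exhaust)
  consider "i' = i + 2" "(j', \<tau>') = (j, \<tau>)" | "i' = i + 1" "j' = j + 1"
    | "(i', \<sigma>') = (i, \<sigma>)" "j' = j + 2"
    using assms(3,4) by (cases v) (auto simp: u_eq w_eq staircase_step_def)
  then show ?thesis
  proof cases
    case 1
    then have "?V = range (\<lambda>\<rho>. ((i + 1, \<rho>), (j, \<tau>)))"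
      using assms(1,2) by (auto simp: u_eq w_eq staircase_defs)
    then show ?thesis using even_card_range_bool[OF inj_signs(1)] by simp
  next
    case 2
    then have "?V = {((i', \<sigma>'), (j, \<tau>)), ((i, \<sigma>), (j', \<tau>'))}"
      using assms(1,2) by (auto simp: u_eq w_eq staircase_defs)
    then show ?thesis using 2 by simp
  next
    case 3
    then have "?V = range (\<lambda>\<rho>. ((i, \<sigma>), (j + 1, \<rho>)))"
      using assms(1,2) by (auto simp: u_eq w_eq staircase_defs)
    then show ?thesis using even_card_range_bool[OF inj_signs(2)] by simp
  qed
qed

lemma even_card_staircase_above:
  assumes "u \<in> staircase_verts a b" "Suc (staircase_rk u) = a + b"
  shows "even (card {w\<in>staircase_verts a b. staircase_rk w = a + b \<and> staircase_step u w})"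
    (is "even (card ?V)")
proof -
  obtain i \<sigma> j \<tau> where u_eq: "u = ((i, \<sigma>), (j, \<tau>))" by (metis prod.exhaust)
  then have "i \<le> a" "j \<le> b" "Suc (i + j) = a + b"
    using assms by (auto simp: staircase_verts_def staircase_rk_def)
  then consider "i = a" "j + 1 = b" | "i + 1 = a" "j = b" by linarith
  then show ?thesis
  proof cases
    case 1
    then have "?V = range (\<lambda>\<rho>. ((i, \<sigma>), (j + 1, \<rho>)))" by (auto simp: u_eq staircase_defs)
    then show ?thesis using even_card_range_bool[OF inj_signs(2)] by simp
  next
    case 2
    then have "?V = range (\<lambda>\<rho>. ((i + 1, \<rho>), (j, \<tau>)))" by (auto simp: u_eq staircase_defs)
    then show ?thesis using even_card_range_bool[OF inj_signs(1)] by simp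
  qed
qed

lemma graded_complex_staircase:
  assumes "0 < a + b"
  shows "graded_complex (staircase a b) flip_left flip_right (a + b) staircase_rk"
  unfolding staircase_def
proof (intro even_graded_relation.graded_complex_graded_chains even_graded_relation.intro
    even_graded_relation_axioms.intro)
  show "free_klein_four_action (staircase_verts a b) flip_left flip_right"
    by (rule free_klein_four_action_staircase_verts)
  show "finite (staircase_verts a b)" by (simp add: staircase_verts_def)
qed (use assms in \<open>simp_all add: even_card_staircase_below even_card_staircase_between
    even_card_staircase_above\<close>,
    auto simp: staircase_rk_def staircase_step_def flip_left_def flip_right_def)

text \<open>The path steps in the first coordinate at the times in \<open>D\<close> and in the second at all others.\<close>

definition lattice_path :: "bool \<Rightarrow> bool \<Rightarrow> nat set \<Rightarrow> nat \<Rightarrow> cross_vertex \<times> cross_vertex" where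
  "lattice_path \<sigma> \<tau> D i = ((card (D \<inter> {..<i}), \<sigma>), (card ({..<i} - D), \<tau>))"

lemma staircase_rk_lattice_path: "staircase_rk (lattice_path \<sigma> \<tau> D i) = i"
  using card_Int_Diff[of "{..<i}" D] by (simp add: staircase_rk_def lattice_path_def Int_commute)

lemma lattice_path_0: "lattice_path \<sigma> \<tau> D 0 = ((0, \<sigma>), (0, \<tau>))"
  by (simp add: lattice_path_def)

lemma lattice_path_Suc:
  "lattice_path \<sigma> \<tau> D (Suc i) =
     (if i \<in> D then apfst (apfst Suc) else apsnd (apfst Suc)) (lattice_path \<sigma> \<tau> D i)"
  by (simp add: lattice_path_def lessThan_Suc Int_insert_right insert_Diff_if)

lemma lattice_path_in_staircase:
  assumes "D \<subseteq> {..<a + b}" "card D = a"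
  shows "lattice_path \<sigma> \<tau> D ` {..a + b} \<in> staircase a b"
proof -
  let ?p = "lattice_path \<sigma> \<tau> D"
  have fin: "finite D" using assms(1) finite_subset by blast
  have "?p i \<in> staircase_verts a b" if "i \<le> a + b" for i
  proof -
    have "card (D \<inter> {..<i}) \<le> card D" using fin by (intro card_mono) auto
    moreover have "card ({..<i} - D) \<le> card ({..<a + b} - D)" using that by (intro card_mono) auto
    moreover have "card ({..<a + b} - D) = b" using assms fin by (simp add: card_Diff_subset)
    ultimately show ?thesis using assms(2) by (simp add: staircase_verts_def lattice_path_def)
  qed
  moreover have "bij_betw staircase_rk (?p ` {..a + b}) {..a + b}"
    by (rule bij_betw_byWitness[of _ ?p]) (auto simp: staircase_rk_lattice_path)
  moreover have "staircase_step (?p i) (?p (Suc i))" for i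
    by (simp add: staircase_step_def lattice_path_Suc apfst_def apsnd_def map_prod_def split_beta)
  ultimately show ?thesis
    by (auto simp: staircase_def graded_chains_def staircase_rk_lattice_path)
qed

lemma card_steps_of_lattice_path:
  assumes "D \<subseteq> {..<a + b}" "lattice_path \<sigma> \<tau> D (a + b) \<in> staircase_verts a b"
  shows "card D = a"
proof -
  have "card (D \<inter> {..<a + b}) \<le> a" "card ({..<a + b} - D) \<le> b"
    using assms(2) by (auto simp: staircase_verts_def lattice_path_def)
  moreover have "card (D \<inter> {..<a + b}) + card ({..<a + b} - D) = a + b"
    using staircase_rk_lattice_path[of \<sigma> \<tau> D "a + b"]
    by (simp add: staircase_rk_def lattice_path_def)
  ultimately show ?thesis using assms(1) by (simp add: Int_absorb2)
qed

lemma lattice_path_image_inject: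
  assumes "D \<subseteq> {..<n}" "D' \<subseteq> {..<n}"
    and image: "lattice_path \<sigma> \<tau> D ` {..n} = lattice_path \<sigma>' \<tau>' D' ` {..n}"
  shows "\<sigma> = \<sigma>'" "\<tau> = \<tau>'" "D = D'"
proof -
  have same_point: "lattice_path \<sigma> \<tau> D i = lattice_path \<sigma>' \<tau>' D' i" if "i \<le> n" for i
  proof -
    have "lattice_path \<sigma> \<tau> D i \<in> lattice_path \<sigma>' \<tau>' D' ` {..n}"
      unfolding image[symmetric] using that by simp
    then obtain j where "lattice_path \<sigma> \<tau> D i = lattice_path \<sigma>' \<tau>' D' j" by blast
    moreover from this have "i = j" using staircase_rk_lattice_path by metis
    ultimately show ?thesis by simp
  qed
  show "\<sigma> = \<sigma>'" "\<tau> = \<tau>'" using same_point[of 0] by (simp_all add: lattice_path_0)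
  have step_iff: "i \<in> D \<longleftrightarrow>
      fst (fst (lattice_path \<sigma> \<tau> D (Suc i))) \<noteq> fst (fst (lattice_path \<sigma> \<tau> D i))" for \<sigma> \<tau> D i
    by (simp add: lattice_path_Suc)
  have "i \<in> D \<longleftrightarrow> i \<in> D'" if "i < n" for i
    using step_iff[of i D \<sigma> \<tau>] step_iff[of i D' \<sigma>' \<tau>'] same_point[of i] same_point[of "Suc i"] that
    by simp
  then show "D = D'" using assms(1,2) by blast
qed

definition signs_agree :: "cross_vertex \<times> cross_vertex \<Rightarrow> bool" where
  "signs_agree v \<longleftrightarrow> snd (fst v) = snd (snd v)"

lemma signs_agree_lattice_path: "signs_agree (lattice_path \<sigma> \<tau> D i) \<longleftrightarrow> \<sigma> = \<tau>"
  by (simp add: signs_agree_def lattice_path_def)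

lemma staircase_step_keeping_agreement:
  assumes "staircase_step u w" "signs_agree u = signs_agree w"
  shows "w = (if fst w \<noteq> fst u then apfst (apfst Suc) else apsnd (apfst Suc)) u"
  using assms by (cases u; cases w) (auto simp: staircase_step_def signs_agree_def)

lemma constant_agreement_imp_lattice_path:
  assumes simplex: "s \<in> staircase a b" and const: "\<And>u v. u \<in> s \<Longrightarrow> v \<in> s \<Longrightarrow> signs_agree u = signs_agree v"
  obtains \<sigma> \<tau> D where "D \<subseteq> {..<a + b}" "card D = a" "s = lattice_path \<sigma> \<tau> D ` {..a + b}"
proof -
  let ?n = "a + b"
  note chain = simplex[unfolded staircase_def]
  have "\<exists>u. u \<in> s \<and> staircase_rk u = i" if "i \<le> ?n" for i
    using graded_chains_vertex[OF chain that] by blast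
  then obtain p where vertex_of_rank: "\<And>i. i \<le> ?n \<Longrightarrow> p i \<in> s" "\<And>i. i \<le> ?n \<Longrightarrow> staircase_rk (p i) = i"
    by metis
  define D where "D = {i. i < ?n \<and> fst (p (Suc i)) \<noteq> fst (p i)}"
  obtain \<sigma> \<tau> where start: "p 0 = ((0, \<sigma>), (0, \<tau>))"
    using vertex_of_rank(2)[of 0] by (cases "p 0") (auto simp: staircase_rk_def)
  have path: "p i = lattice_path \<sigma> \<tau> D i" if "i \<le> ?n" for i
    using that
  proof (induction i)
    case 0
    show ?case by (simp add: start lattice_path_0)
  next
    case (Suc i)
    have "staircase_step (p i) (p (Suc i))"
      by (rule graded_chainsD(5)[OF chain]) (use vertex_of_rank Suc.prems in simp_all)
    moreover have "signs_agree (p i) = signs_agree (p (Suc i))"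
      using const vertex_of_rank(1) Suc.prems by simp
    ultimately have "p (Suc i) =
        (if fst (p (Suc i)) \<noteq> fst (p i) then apfst (apfst Suc) else apsnd (apfst Suc)) (p i)"
      by (rule staircase_step_keeping_agreement)
    then show ?case using Suc by (simp add: lattice_path_Suc D_def)
  qed
  have times: "D \<subseteq> {..<?n}" by (auto simp: D_def)
  have "p ?n \<in> staircase_verts a b" using vertex_of_rank(1) graded_chainsD(1)[OF chain] by blast
  then have "card D = a" using times path[of ?n] by (simp add: card_steps_of_lattice_path)
  moreover have "s = lattice_path \<sigma> \<tau> D ` {..?n}"
  proof (intro equalityI subsetI)
    fix v assume member: "v \<in> s"
    then have "staircase_rk v \<le> ?n" using graded_chainsD(7)[OF chain] by blast
    then have "v = p (staircase_rk v)"
      using vertex_of_rank member graded_chainsD(6)[OF chain] by metis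
    then show "v \<in> lattice_path \<sigma> \<tau> D ` {..?n}"
      using path \<open>staircase_rk v \<le> ?n\<close> by (metis atMost_iff imageI)
  qed (use vertex_of_rank(1) path in auto)
  ultimately show thesis using that times by blast
qed

lemma card_constant_agreement:
  "card {s\<in>staircase a b. \<forall>u\<in>s. \<forall>v\<in>s. signs_agree u = signs_agree v} = 4 * ((a + b) choose a)"
proof -
  define X where "X = (UNIV :: bool set) \<times> (UNIV :: bool set) \<times> {D. D \<subseteq> {..<a + b} \<and> card D = a}"
  define \<Psi> where "\<Psi> = (\<lambda>(\<sigma>, \<tau>, D). lattice_path \<sigma> \<tau> D ` {..a + b})"
  have "inj_on \<Psi> X"
    by (rule inj_onI) (auto simp: X_def \<Psi>_def dest: lattice_path_image_inject)
  moreover have "\<Psi> ` X = {s\<in>staircase a b. \<forall>u\<in>s. \<forall>v\<in>s. signs_agree u = signs_agree v}"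
  proof (intro equalityI subsetI)
    fix s assume "s \<in> {s\<in>staircase a b. \<forall>u\<in>s. \<forall>v\<in>s. signs_agree u = signs_agree v}"
    then have "s \<in> staircase a b" "\<And>u v. u \<in> s \<Longrightarrow> v \<in> s \<Longrightarrow> signs_agree u = signs_agree v" by blast+
    then obtain \<sigma> \<tau> D where "D \<subseteq> {..<a + b}" "card D = a" "s = lattice_path \<sigma> \<tau> D ` {..a + b}"
      by (rule constant_agreement_imp_lattice_path)
    then have "(\<sigma>, \<tau>, D) \<in> X" "s = \<Psi> (\<sigma>, \<tau>, D)" by (simp_all add: X_def \<Psi>_def)
    then show "s \<in> \<Psi> ` X" by blast
  qed (auto simp: X_def \<Psi>_def lattice_path_in_staircase signs_agree_lattice_path)
  moreover have "card X = 4 * ((a + b) choose a)"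
    by (simp add: X_def card_cartesian_product n_subsets)
  ultimately show ?thesis using card_image[of \<Psi> X] by simp
qed

lemma ex_simplex_vectors:
  fixes W :: "'w::euclidean_space set"
  assumes ambient: "subspace W" "dim W = n"
  obtains \<beta> :: "nat \<Rightarrow> 'w" where "\<And>j. \<beta> j \<in> W" "(\<Sum>j\<le>n. \<beta> j) = 0"
    "\<And>c j. linear_relation \<beta> {..n} c \<Longrightarrow> j \<le> n \<Longrightarrow> c j = c n"
proof -
  obtain B where basis: "B \<subseteq> W" "independent B" "card B = n"
    using basis_exists[of W] ambient(2) by metis
  have finB: "finite B" using basis(2) by (rule finiteI_independent)
  obtain e where enum: "bij_betw e {..<n} B"
    using ex_bij_betw_nat_finite[OF finB] basis(3) by (auto simp: atLeast0LessThan)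
  then have enum_in_basis: "e j \<in> B" if "j < n" for j using that by (auto simp: bij_betw_def)
  define \<beta> where "\<beta> j = (if j < n then e j else - (\<Sum>i<n. e i))" for j
  have split: "(\<Sum>j\<le>n. c j *\<^sub>R \<beta> j) = (\<Sum>j<n. (c j - c n) *\<^sub>R e j)" for c
    by (simp add: \<beta>_def lessThan_Suc_atMost[symmetric] scaleR_diff_left sum_subtractf scaleR_sum_right)
  show thesis
  proof
    have "(\<Sum>i<n. e i) \<in> W" using enum_in_basis basis(1) ambient(1) by (intro subspace_sum) auto
    then show "\<beta> j \<in> W" for j
      using enum_in_basis basis(1) subspace_neg[OF ambient(1)] by (auto simp: \<beta>_def)
    show "(\<Sum>j\<le>n. \<beta> j) = 0" using split[of "\<lambda>_. 1"] by simp
    fix c j assume "linear_relation \<beta> {..n} c" "j \<le> n"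
    then have rel: "(\<Sum>i<n. (c i - c n) *\<^sub>R e i) = 0" by (simp add: linear_relation_def split)
    define k where "k = (\<lambda>i. c i - c n) \<circ> the_inv_into {..<n} e"
    have k_at_enum: "k (e i) = c i - c n" if "i < n" for i
      using that enum by (simp add: k_def bij_betw_def the_inv_into_f_f)
    have "(\<Sum>x\<in>B. k x *\<^sub>R x) = 0"
      using sum.reindex_bij_betw[OF enum, of "\<lambda>x. k x *\<^sub>R x"] rel k_at_enum by simp
    then have "k (e j) = 0" if "j < n"
      using independentD[OF basis(2) finB order_refl] enum_in_basis[OF that] by blast
    then show "c j = c n" using k_at_enum[of j] \<open>j \<le> n\<close> by (cases "j = n") auto
  qed
qed

lemma balanced_signed_simplex_vectors_iff:
  fixes \<beta> :: "nat \<Rightarrow> 'w::real_vector" and \<epsilon> :: "'v \<Rightarrow> real"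
  assumes only_constant: "\<And>c j. linear_relation \<beta> {..n} c \<Longrightarrow> j \<le> n \<Longrightarrow> c j = c n" and "(\<Sum>j\<le>n. \<beta> j) = 0"
    and bij: "bij_betw rk s {..n}" and sign: "\<And>v. \<epsilon> v \<in> {1, -1}" and subset: "X \<subseteq> s"
  shows "balanced (\<lambda>v. \<epsilon> v *\<^sub>R \<beta> (rk v)) X \<longleftrightarrow> X = s \<and> (\<forall>u\<in>s. \<forall>v\<in>s. \<epsilon> u = \<epsilon> v)"
    (is "balanced ?z X \<longleftrightarrow> _")
proof
  have fin: "finite s" using bij bij_betw_finite by blast
  then have "finite X" using subset finite_subset by blast
  moreover assume "balanced ?z X"
  ultimately obtain c u where relation: "linear_relation ?z X c" "\<forall>v\<in>X. 0 \<le> c v" "u \<in> X" "c u \<noteq> 0"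
    using balanced_iff_nonneg_relation[of X ?z] by (auto simp: nonneg_relation_def)
  define c' where "c' v = (if v \<in> X then c v else 0)" for v
  define p where "p = the_inv_into s rk"
  have p_rk: "p (rk v) = v" if "v \<in> s" for v
    using that bij by (simp add: p_def bij_betw_def the_inv_into_f_f)
  have rk_le: "rk v \<le> n" if "v \<in> s" for v using that bij by (auto simp: bij_betw_def)
  have "linear_relation ?z s c'"
    unfolding c'_def using linear_relation_extend[OF fin subset] relation(1) by blast
  then have "linear_relation \<beta> {..n} (\<lambda>j. c' (p j) * \<epsilon> (p j))"
    using sum.reindex_bij_betw[OF bij, of "\<lambda>j. (c' (p j) * \<epsilon> (p j)) *\<^sub>R \<beta> j"]
    by (simp add: linear_relation_def p_rk)
  then have const: "c' v * \<epsilon> v = c' u * \<epsilon> u" if "v \<in> s" for v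
    using only_constant[of "\<lambda>j. c' (p j) * \<epsilon> (p j)"] rk_le p_rk that relation(3) subset
    by (metis subsetD)
  have "0 < c' u" using relation by (force simp: c'_def)
  then have "c' v \<noteq> 0" if "v \<in> s" for v using const[OF that] sign[of u] by auto
  then have "X = s" using subset by (metis c'_def subsetI subset_antisym)
  moreover have "\<epsilon> v = \<epsilon> u" if "v \<in> s" for v
  proof -
    have "0 \<le> c' v" using relation(2) by (simp add: c'_def)
    then show ?thesis using const[OF that] sign[of v] sign[of u] \<open>0 < c' u\<close> by auto
  qed
  ultimately show "X = s \<and> (\<forall>u\<in>s. \<forall>v\<in>s. \<epsilon> u = \<epsilon> v)" by simp
next
  assume equal_signs: "X = s \<and> (\<forall>u\<in>s. \<forall>v\<in>s. \<epsilon> u = \<epsilon> v)"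
  obtain u where member: "u \<in> s" using bij by (metis atMost_iff bij_betw_iff_bijections order_refl)
  have "(\<Sum>v\<in>s. \<epsilon> v *\<^sub>R \<beta> (rk v)) = (\<Sum>v\<in>s. \<epsilon> u *\<^sub>R \<beta> (rk v))"
    using equal_signs member by (intro sum.cong) (metis, metis)
  also have "\<dots> = \<epsilon> u *\<^sub>R (\<Sum>j\<le>n. \<beta> j)"
    using sum.reindex_bij_betw[OF bij, of \<beta>] by (simp add: scaleR_sum_right[symmetric])
  finally have "nonneg_relation ?z s (\<lambda>_. 1)"
    using member assms(2) by (auto simp: nonneg_relation_def linear_relation_def)
  then show "balanced ?z X"
    using equal_signs bij bij_betw_finite balanced_iff_nonneg_relation[of s ?z] by blast
qed

lemma ex_essential_labelling_staircase:
  fixes W :: "'w::euclidean_space set"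
  assumes binomial: "0 < a + b" "odd ((a + b) choose a)" and ambient: "subspace W" "dim W = a + b"
  shows "\<exists>z :: _ \<Rightarrow> 'w.
    essential_labelling (staircase a b) flip_left flip_right (a + b) staircase_rk W z"
proof -
  obtain \<beta> :: "nat \<Rightarrow> 'w" where simplex_vectors: "\<And>j. \<beta> j \<in> W" "(\<Sum>j\<le>a + b. \<beta> j) = 0"
    "\<And>c j. linear_relation \<beta> {..a + b} c \<Longrightarrow> j \<le> a + b \<Longrightarrow> c j = c (a + b)"
    using ex_simplex_vectors[OF ambient] by blast
  define \<epsilon> :: "cross_vertex \<times> cross_vertex \<Rightarrow> real" where "\<epsilon> v = (if signs_agree v then 1 else -1)" for v
  define z where "z v = \<epsilon> v *\<^sub>R \<beta> (staircase_rk v)" for v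
  interpret graded_complex "staircase a b" flip_left flip_right "a + b" staircase_rk
    by (rule graded_complex_staircase[OF binomial(1)])
  have sign: "\<epsilon> v \<in> {1, -1}" for v by (simp add: \<epsilon>_def)
  have bal: "balanced z X \<longleftrightarrow> X = s \<and> (\<forall>u\<in>s. \<forall>v\<in>s. signs_agree u = signs_agree v)"
    if "s \<in> staircase a b" "X \<subseteq> s" for s X
  proof -
    have "\<epsilon> u = \<epsilon> v \<longleftrightarrow> signs_agree u = signs_agree v" for u v by (simp add: \<epsilon>_def)
    then show ?thesis
      using balanced_signed_simplex_vectors_iff[OF simplex_vectors(3,2) rk_bij[OF that(1)] sign that(2)]
      by (simp add: z_def[abs_def])
  qed
  have "essential_labelling (staircase a b) flip_left flip_right (a + b) staircase_rk W z"
  proof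
    show "odd_labelling (staircase a b) flip_left flip_right z"
      by (auto simp: odd_labelling_def z_def \<epsilon>_def signs_agree_def staircase_rk_def
          flip_left_def flip_right_def)
    show "generic_labelling (staircase a b) z"
      unfolding generic_labelling_def
    proof (intro ballI)
      fix s v assume "s \<in> staircase a b" "v \<in> s"
      then show "\<not> balanced z (s - {v})" using bal[of s "s - {v}"] by blast
    qed
    show "z ` \<Union>(staircase a b) \<subseteq> W"
      using simplex_vectors(1) ambient(1) by (auto simp: z_def subspace_scale)
    have "{s\<in>staircase a b. balanced z s} =
        {s\<in>staircase a b. \<forall>u\<in>s. \<forall>v\<in>s. signs_agree u = signs_agree v}"
      using bal by blast
    then have "num_balanced (staircase a b) z = 4 * ((a + b) choose a)"
      using card_constant_agreement by (simp add: num_balanced_def)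
    then show "\<not> 8 dvd num_balanced (staircase a b) z"
      using binomial(2) nat_mult_dvd_cancel_disj[of 4 2] by simp
  qed (fact ambient)+
  then show ?thesis by blast
qed

lemma even_binomial_power_2:
  assumes "0 < k" "k < 2 ^ t"
  shows "even ((2 ^ t) choose k :: nat)"
proof (rule ccontr)
  assume "odd ((2 ^ t) choose k :: nat)"
  then have coprime: "coprime (2 ^ t) ((2 ^ t) choose k :: nat)" by simp
  have "k * ((2 ^ t) choose k) = 2 ^ t * ((2 ^ t - 1) choose (k - 1))"
    using binomial_absorption[of "k - 1" "2 ^ t"] assms(1) by simp
  then have "2 ^ t dvd k" using coprime coprime_dvd_mult_left_iff by (metis dvd_triv_left)
  then show False using assms by (simp add: nat_dvd_not_less)
qed

lemma odd_binomial_power_2_minus_1: "k < 2 ^ t \<Longrightarrow> odd ((2 ^ t - 1) choose k :: nat)"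
proof (induction k)
  case (Suc k)
  have "(2 ^ t) choose (Suc k) = ((2 ^ t - 1) choose k) + ((2 ^ t - 1) choose Suc k :: nat)"
    using binomial_Suc_Suc[of "2 ^ t - 1" k] by simp
  then show ?case
    using even_binomial_power_2[of "Suc k" t] Suc by (metis Suc_lessD even_add zero_less_Suc)
qed simp

section \<open>Fine equivariant triangulations\<close>

text \<open>The radius \<open>r\<close> keeps the simplices away from the points where one of the radial projections to
  the spheres is undefined.\<close>

definition realization ::
  "'v set set \<Rightarrow> ('v \<Rightarrow> 'v) \<Rightarrow> ('v \<Rightarrow> 'v) \<Rightarrow> ('v \<Rightarrow> 'a::euclidean_space \<times> 'b::euclidean_space) \<Rightarrow>
     real \<Rightarrow> real \<Rightarrow> bool" where
  "realization F g h pos r \<delta> \<longleftrightarrow>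
     (\<forall>v\<in>\<Union>F. pos (g v) = g1 (pos v) \<and> pos (h v) = g2 (pos v)) \<and>
     (\<forall>s\<in>F. \<forall>q\<in>convex hull (pos ` s). r \<le> norm (fst q) \<and> r \<le> norm (snd q)) \<and>
     (\<forall>s\<in>F. \<forall>u\<in>s. \<forall>v\<in>s. dist (pos u) (pos v) \<le> \<delta>)"

lemma realizationD:
  assumes "realization F g h pos r \<delta>"
  shows "v \<in> \<Union>F \<Longrightarrow> pos (g v) = g1 (pos v)" "v \<in> \<Union>F \<Longrightarrow> pos (h v) = g2 (pos v)"
    and "s \<in> F \<Longrightarrow> q \<in> convex hull (pos ` s) \<Longrightarrow> r \<le> norm (fst q)"
    and "s \<in> F \<Longrightarrow> q \<in> convex hull (pos ` s) \<Longrightarrow> r \<le> norm (snd q)"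
    and "s \<in> F \<Longrightarrow> u \<in> s \<Longrightarrow> v \<in> s \<Longrightarrow> dist (pos u) (pos v) \<le> \<delta>"
  using assms unfolding realization_def by blast+

lemma realization_mono: "realization F g h pos r \<delta> \<Longrightarrow> \<delta> \<le> \<delta>' \<Longrightarrow> realization F g h pos r \<delta>'"
  unfolding realization_def by (meson order_trans)

definition barycenter :: "('v \<Rightarrow> 'p::real_vector) \<Rightarrow> 'v set \<Rightarrow> 'p" where
  "barycenter pos X = (1 / card X) *\<^sub>R (\<Sum>x\<in>X. pos x)"

lemma barycenter_in_convex_hull:
  assumes "finite X" "X \<noteq> {}"
  shows "barycenter pos X \<in> convex hull (pos ` X)"
proof -
  have "(\<Sum>x\<in>X. (1 / card X) *\<^sub>R pos x) \<in> convex hull (pos ` X)"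
    using assms by (intro convex_sum convex_convex_hull hull_inc) auto
  then show ?thesis by (simp add: barycenter_def scaleR_sum_right)
qed

lemma barycenter_image_linear:
  assumes "linear f" "inj_on g X" "\<And>x. x \<in> X \<Longrightarrow> pos (g x) = f (pos x)"
  shows "barycenter pos (g ` X) = f (barycenter pos X)"
  using assms by (simp add: barycenter_def card_image sum.reindex linear_scale linear_sum)

lemma dist_vertex_barycenter_le:
  fixes pos :: "'v \<Rightarrow> 'p::real_normed_vector"
  assumes vertex: "finite Y" "x \<in> Y" and close: "\<And>y. y \<in> Y \<Longrightarrow> dist (pos x) (pos y) \<le> \<delta>"
  shows "dist (pos x) (barycenter pos Y) \<le> \<delta> * (real (card Y - 1) / real (card Y))"
proof -
  have "card Y > 0" using vertex by (auto simp: card_gt_0_iff)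
  then have "pos x - barycenter pos Y = (1 / card Y) *\<^sub>R (\<Sum>y\<in>Y. pos x - pos y)"
    by (simp add: barycenter_def sum_subtractf scaleR_diff_right sum_constant_scaleR)
  also have "(\<Sum>y\<in>Y. pos x - pos y) = (\<Sum>y\<in>Y - {x}. pos x - pos y)"
    using vertex by (intro sum.mono_neutral_right) auto
  finally have "dist (pos x) (barycenter pos Y) = (1 / card Y) * norm (\<Sum>y\<in>Y - {x}. pos x - pos y)"
    by (simp add: dist_norm)
  also have "norm (\<Sum>y\<in>Y - {x}. pos x - pos y) \<le> (\<Sum>y\<in>Y - {x}. \<delta>)"
    using close by (intro sum_norm_le) (auto simp: dist_norm)
  also have "\<dots> = (card Y - 1) * \<delta>" using vertex by simp
  finally show ?thesis by (simp add: divide_right_mono mult_ac)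
qed

lemma dist_barycenter_le:
  fixes pos :: "'v \<Rightarrow> 'p::real_normed_vector"
  assumes bound: "finite Y" "card Y \<le> n + 1" and subset: "X \<subseteq> Y" "X \<noteq> {}"
    and diameter: "\<And>x y. x \<in> Y \<Longrightarrow> y \<in> Y \<Longrightarrow> dist (pos x) (pos y) \<le> \<delta>"
  shows "dist (barycenter pos X) (barycenter pos Y) \<le> \<delta> * (real n / real (n + 1))"
proof -
  have "0 \<le> \<delta>" using diameter subset by (metis all_not_in_conv dist_self subsetD)
  have "0 < card Y" using subset bound(1) by (auto simp: card_gt_0_iff)
  then have "real (card Y - 1) / real (card Y) \<le> real n / real (n + 1)"
    using bound(2) by (simp add: field_simps of_nat_diff)
  then have ratio: "\<delta> * (real (card Y - 1) / real (card Y)) \<le> \<delta> * (real n / real (n + 1))"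
    using \<open>0 \<le> \<delta>\<close> by (rule mult_left_mono)
  have "pos x \<in> cball (barycenter pos Y) (\<delta> * (real n / real (n + 1)))" if "x \<in> X" for x
  proof -
    have "x \<in> Y" using that subset(1) by blast
    then have "dist (pos x) (barycenter pos Y) \<le> \<delta> * (real (card Y - 1) / real (card Y))"
      using diameter by (intro dist_vertex_barycenter_le bound(1))
    then show ?thesis using ratio by (simp add: dist_commute)
  qed
  then have "convex hull (pos ` X) \<subseteq> cball (barycenter pos Y) (\<delta> * (real n / real (n + 1)))"
    by (intro hull_minimal convex_cball) blast
  moreover have "barycenter pos X \<in> convex hull (pos ` X)"
    using subset bound(1) finite_subset by (intro barycenter_in_convex_hull) auto
  ultimately have "barycenter pos X \<in> cball (barycenter pos Y) (\<delta> * (real n / real (n + 1)))"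
    by blast
  then show ?thesis by (simp only: mem_cball dist_commute)
qed

lemma linear_g1: "linear g1" and linear_g2: "linear g2"
  by (auto intro!: linearI simp: g1_def g2_def)

context graded_complex
begin

lemma realization_subdivision:
  assumes real: "realization F g h pos r \<delta>"
  shows "realization (subdivision n F) ((`) g) ((`) h) (barycenter pos) r (\<delta> * (real n / real (n + 1)))"
  unfolding realization_def
proof (intro conjI ballI)
  fix X assume "X \<in> \<Union>(subdivision n F)"
  then have in_verts: "X \<subseteq> \<Union>F" using subdivision_subset_faces face_subset_verts by blast
  show "barycenter pos (g ` X) = g1 (barycenter pos X)" "barycenter pos (h ` X) = g2 (barycenter pos X)"
    using in_verts inj_on_g inj_on_h realizationD(1,2)[OF real]
    by (auto intro!: barycenter_image_linear linear_g1 linear_g2 intro: inj_on_subset)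
next
  fix \<sigma> q assume chain: "\<sigma> \<in> subdivision n F" and in_hull: "q \<in> convex hull (barycenter pos ` \<sigma>)"
  obtain s where carrier: "s \<in> F" "\<And>X. X \<in> \<sigma> \<Longrightarrow> X \<subseteq> s" using subdivision_carrier[OF chain] by blast
  have "barycenter pos X \<in> convex hull (pos ` s)" if in_chain: "X \<in> \<sigma>" for X
  proof -
    have "X \<in> faces F" using subdivision_subset_faces[OF chain] in_chain by blast
    then have "barycenter pos X \<in> convex hull (pos ` X)"
      by (intro barycenter_in_convex_hull finite_face) (auto simp: faces_def)
    then show ?thesis using carrier(2)[OF in_chain] by (meson hull_mono image_mono subsetD)
  qed
  then have "convex hull (barycenter pos ` \<sigma>) \<subseteq> convex hull (pos ` s)"
    by (intro hull_minimal convex_convex_hull) blast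
  then show "r \<le> norm (fst q)" "r \<le> norm (snd q)"
    using realizationD(3,4)[OF real carrier(1)] in_hull by blast+
next
  fix \<sigma> X Y assume chain: "\<sigma> \<in> subdivision n F" "X \<in> \<sigma>" "Y \<in> \<sigma>"
  have ordered: "dist (barycenter pos X) (barycenter pos Y) \<le> \<delta> * (real n / real (n + 1))"
    if nested: "X \<in> \<sigma>" "Y \<in> \<sigma>" "face_dim X \<le> face_dim Y" for X Y
  proof (rule dist_barycenter_le)
    have faces: "X \<in> faces F" "Y \<in> faces F"
      using subdivision_subset_faces[OF chain(1)] nested by blast+
    then obtain s where carrier: "s \<in> F" "Y \<subseteq> s" by (auto simp: faces_def)
    show "finite Y" "X \<noteq> {}" using faces finite_face by (auto simp: faces_def)
    show "card Y \<le> n + 1"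
      using card_mono[OF finite_simplex[OF carrier(1)] carrier(2)] card_simplex[OF carrier(1)]
      by simp
    show "X \<subseteq> Y" by (rule subdivision_nested[OF chain(1) nested])
    show "dist (pos x) (pos y) \<le> \<delta>" if "x \<in> Y" "y \<in> Y" for x y
      using realizationD(5)[OF real carrier(1)] carrier(2) that by blast
  qed
  show "dist (barycenter pos X) (barycenter pos Y) \<le> \<delta> * (real n / real (n + 1))"
    using ordered[OF chain(2,3)] ordered[OF chain(3,2)] by (metis dist_commute nle_le)
qed

lemma realization_rename:
  assumes real: "realization F g h pos r \<delta>" and inj: "inj_on e (\<Union>F)"
  defines "d \<equiv> inv_into (\<Union>F) e"
  shows "realization ((`) e ` F) (\<lambda>u. e (g (d u))) (\<lambda>u. e (h (d u))) (\<lambda>u. pos (d u)) r \<delta>"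
proof -
  have decode_encode: "d (e v) = v" if "v \<in> \<Union>F" for v using that inj by (simp add: d_def)
  have image: "(\<lambda>u. pos (d u)) ` e ` s = pos ` s" if "s \<in> F" for s
    by (simp add: image_image decode_encode[OF UnionI[OF that]] cong: image_cong_simp)
  show ?thesis
    unfolding realization_def
  proof (intro conjI ballI)
    fix u assume "u \<in> \<Union>((`) e ` F)"
    then obtain v where vertex: "v \<in> \<Union>F" "u = e v" by blast
    then show "pos (d (e (g (d u)))) = g1 (pos (d u))" "pos (d (e (h (d u)))) = g2 (pos (d u))"
      using realizationD(1,2)[OF real vertex(1)] g_closed h_closed
      by (simp_all add: decode_encode del: Union_iff)
  next
    fix s' q assume "s' \<in> (`) e ` F" "q \<in> convex hull ((\<lambda>u. pos (d u)) ` s')"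
    then obtain s where "s \<in> F" "q \<in> convex hull (pos ` s)" using image by auto
    then show "r \<le> norm (fst q)" "r \<le> norm (snd q)" using realizationD(3,4)[OF real] by blast+
  next
    fix s' u u' assume "s' \<in> (`) e ` F" "u \<in> s'" "u' \<in> s'"
    then obtain s v v' where "s \<in> F" "v \<in> s" "v' \<in> s" "u = e v" "u' = e v'" by blast
    then show "dist (pos (d u)) (pos (d u')) \<le> \<delta>"
      using realizationD(5)[OF real] decode_encode[OF UnionI] by simp
  qed
qed

end

lemma one_le_card_mult_norm_orthonormal_hull:
  fixes X :: "'p::euclidean_space set"
  assumes orthonormal: "finite X" "pairwise orthogonal X" "\<And>x. x \<in> X \<Longrightarrow> norm x = 1"
    and in_hull: "q \<in> convex hull X"
  shows "1 \<le> real (card X) * norm q"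
proof -
  have "\<Sum>X \<bullet> x = 1" if "x \<in> X" for x
  proof -
    have "\<Sum>X \<bullet> x = (\<Sum>y\<in>X. if y = x then 1 else 0)"
      unfolding inner_sum_left using orthonormal(2,3) that
      by (intro sum.cong) (auto simp: pairwise_def orthogonal_def norm_eq_1)
    then show ?thesis using orthonormal(1) that by simp
  qed
  then have "convex hull X \<subseteq> {q. \<Sum>X \<bullet> q = 1}"
    by (intro hull_minimal convex_hyperplane) blast
  then have "1 \<le> norm (\<Sum>X) * norm q" using in_hull norm_cauchy_schwarz[of "\<Sum>X" q] by auto
  also have "norm (\<Sum>X) \<le> (\<Sum>x\<in>X. 1)" using orthonormal(3) by (intro sum_norm_le) simp
  finally show ?thesis by (simp add: mult_right_mono)
qed

definition cross_point :: "(nat \<Rightarrow> 'p::real_vector) \<Rightarrow> cross_vertex \<Rightarrow> 'p" where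
  "cross_point e x = (if snd x then e (fst x) else - e (fst x))"

lemma one_le_norm_cross_hull:
  fixes e :: "nat \<Rightarrow> 'p::euclidean_space"
  assumes basis: "inj_on e {..k}" "e ` {..k} \<subseteq> Basis"
    and indices: "inj_on fst X" "fst ` X \<subseteq> {..k}" and in_hull: "q \<in> convex hull (cross_point e ` X)"
  shows "1 \<le> real (k + 1) * norm q"
proof -
  have card: "finite X" "card X \<le> k + 1"
    using indices finite_subset card_mono[of "{..k}" "fst ` X"] finite_imageD[OF _ indices(1)]
    by (auto simp: card_image)
  have "cross_point e x \<bullet> cross_point e y = (if fst x = fst y then 1 else 0)"
    if "x \<in> X" "y \<in> X" "fst x \<noteq> fst y \<or> x = y" for x y
  proof -
    have "e (fst x) \<bullet> e (fst y) = (if fst x = fst y then 1 else 0)"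
      using that indices(2) basis by (auto simp: inner_Basis inj_on_def image_subset_iff)
    then show ?thesis using that(3) by (auto simp: cross_point_def)
  qed
  then have "pairwise orthogonal (cross_point e ` X)" "\<And>x. x \<in> X \<Longrightarrow> norm (cross_point e x) = 1"
    using indices(1) by (auto simp: pairwise_def orthogonal_def norm_eq_1 inj_on_def)
  then have "1 \<le> real (card (cross_point e ` X)) * norm q"
    using card(1) in_hull by (intro one_le_card_mult_norm_orthonormal_hull) auto
  also have "real (card (cross_point e ` X)) \<le> real (k + 1)"
    using card card_image_le[of X "cross_point e"] by linarith
  finally show ?thesis by (simp add: mult_right_mono)
qed

lemma staircase_step_rtranclp_mono:
  assumes "staircase_step\<^sup>*\<^sup>* u w"
  shows "fst (fst u) \<le> fst (fst w)" "fst (fst u) = fst (fst w) \<Longrightarrow> fst u = fst w"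
    "fst (snd u) \<le> fst (snd w)" "fst (snd u) = fst (snd w) \<Longrightarrow> snd u = snd w"
  using assms by (induction rule: rtranclp_induct) (auto simp: staircase_step_def)

lemma inj_on_fst_staircase:
  assumes "s \<in> staircase a b"
  shows "inj_on fst (fst ` s)" "inj_on fst (snd ` s)"
proof -
  have "(fst (fst u) = fst (fst w) \<longrightarrow> fst u = fst w) \<and> (fst (snd u) = fst (snd w) \<longrightarrow> snd u = snd w)"
    if "u \<in> s" "w \<in> s" for u w
    using graded_chains_rtranclp[OF assms[unfolded staircase_def]] staircase_step_rtranclp_mono that
    by (metis nle_le)
  then show "inj_on fst (fst ` s)" "inj_on fst (snd ` s)" by (simp_all add: inj_on_def)
qed

definition cross_pair :: "(nat \<Rightarrow> 'a::real_vector) \<Rightarrow> (nat \<Rightarrow> 'b::real_vector) \<Rightarrow>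
    cross_vertex \<times> cross_vertex \<Rightarrow> 'a \<times> 'b" where
  "cross_pair e f v = (cross_point e (fst v), cross_point f (snd v))"

lemma cross_pair_flip_left: "cross_pair e f (flip_left v) = g1 (cross_pair e f v)"
  and cross_pair_flip_right: "cross_pair e f (flip_right v) = g2 (cross_pair e f v)"
  by (simp_all add: cross_pair_def cross_point_def flip_left_def flip_right_def g1_def g2_def)

lemma norm_ge_in_staircase_hull:
  fixes e :: "nat \<Rightarrow> 'a::euclidean_space" and f :: "nat \<Rightarrow> 'b::euclidean_space"
  assumes e_basis: "inj_on e {..a}" "e ` {..a} \<subseteq> Basis"
    and f_basis: "inj_on f {..b}" "f ` {..b} \<subseteq> Basis"
    and simplex: "s \<in> staircase a b" and q_in_hull: "q \<in> convex hull (cross_pair e f ` s)"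
  shows "1 / real (a + b + 1) \<le> norm (fst q)" "1 / real (a + b + 1) \<le> norm (snd q)"
proof -
  have "s \<subseteq> staircase_verts a b" using simplex unfolding staircase_def by (rule graded_chainsD(1))
  then have index: "fst ` fst ` s \<subseteq> {..a}" "fst ` snd ` s \<subseteq> {..b}"
    by (auto simp: staircase_verts_def)
  have hulls: "fst q \<in> convex hull (cross_point e ` fst ` s)"
    "snd q \<in> convex hull (cross_point f ` snd ` s)"
    using q_in_hull convex_hull_linear_image[OF linear_fst, of "cross_pair e f ` s"]
      convex_hull_linear_image[OF linear_snd, of "cross_pair e f ` s"]
    by (auto simp: cross_pair_def image_image)
  have "1 \<le> real (a + 1) * norm (fst q)"
    by (rule one_le_norm_cross_hull[OF e_basis inj_on_fst_staircase(1)[OF simplex] index(1) hulls(1)])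
  also have "\<dots> \<le> real (a + b + 1) * norm (fst q)" by (intro mult_right_mono) auto
  finally show "1 / real (a + b + 1) \<le> norm (fst q)" by (simp add: pos_divide_le_eq mult.commute)
  have "1 \<le> real (b + 1) * norm (snd q)"
    by (rule one_le_norm_cross_hull[OF f_basis inj_on_fst_staircase(2)[OF simplex] index(2) hulls(2)])
  also have "\<dots> \<le> real (a + b + 1) * norm (snd q)" by (intro mult_right_mono) auto
  finally show "1 / real (a + b + 1) \<le> norm (snd q)" by (simp add: pos_divide_le_eq mult.commute)
qed

lemma ex_realization_staircase:
  assumes "0 < a + b" "a < DIM('a::euclidean_space)" "b < DIM('b::euclidean_space)"
  shows "\<exists>(pos :: _ \<Rightarrow> 'a \<times> 'b) \<delta>.
    realization (staircase a b) flip_left flip_right pos (1 / real (a + b + 1)) \<delta>"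
proof -
  have ex_basis: "\<exists>e. inj_on e {..k} \<and> e ` {..k} \<subseteq> (Basis :: 'p::euclidean_space set)"
    if "k < DIM('p)" for k
    using that card_le_inj[of "{..k}" "Basis :: 'p set"] by auto
  obtain e where e_basis: "inj_on e {..a}" "e ` {..a} \<subseteq> (Basis :: 'a set)"
    using ex_basis[OF assms(2)] by blast
  obtain f where f_basis: "inj_on f {..b}" "f ` {..b} \<subseteq> (Basis :: 'b set)"
    using ex_basis[OF assms(3)] by blast
  interpret graded_complex "staircase a b" flip_left flip_right "a + b" staircase_rk
    by (rule graded_complex_staircase[OF assms(1)])
  let ?X = "cross_pair e f ` \<Union>(staircase a b)"
  have "bounded ?X" using finite_verts by (intro finite_imp_bounded finite_imageI)
  then obtain \<delta> where diameter: "\<forall>p\<in>?X. \<forall>q\<in>?X. dist p q \<le> \<delta>"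
    unfolding bounded_two_points ..
  have "realization (staircase a b) flip_left flip_right (cross_pair e f) (1 / real (a + b + 1)) \<delta>"
    unfolding realization_def
  proof (intro conjI ballI)
    show "dist (cross_pair e f u) (cross_pair e f v) \<le> \<delta>"
      if "s \<in> staircase a b" "u \<in> s" "v \<in> s" for s u v
      using diameter that by blast
  qed (use norm_ge_in_staircase_hull[OF e_basis f_basis] in
      \<open>simp_all only: cross_pair_flip_left cross_pair_flip_right\<close>)
  then show ?thesis by blast
qed

text \<open>Subdivision turns vertices into sets of vertices. Renaming them as natural numbers is what
  allows it to be iterated.\<close>

lemma (in essential_labelling) ex_nat_renaming:
  fixes pos :: "'v \<Rightarrow> 'a::euclidean_space \<times> 'b::euclidean_space"
  assumes "realization F g h pos r \<delta>"
  shows "\<exists>(F' :: nat set set) g' h' rk' z' (pos' :: nat \<Rightarrow> 'a \<times> 'b).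
    essential_labelling F' g' h' n rk' W z' \<and> realization F' g' h' pos' r \<delta>"
proof -
  obtain e :: "'v \<Rightarrow> nat" where inj: "inj_on e (\<Union>F)"
    using finite_imp_inj_to_nat_seg[OF finite_verts] by blast
  show ?thesis
    using essential_labelling_rename[OF inj] realization_rename[OF assms inj]
    by (intro exI conjI)
qed

theorem ex_fine_essential_labelling:
  fixes W :: "'w::euclidean_space set"
  assumes binomial: "0 < a + b" "odd ((a + b) choose a)" and ambient: "subspace W" "dim W = a + b"
    and dims: "a < DIM('a::euclidean_space)" "b < DIM('b::euclidean_space)" and "0 < \<delta>"
  shows "\<exists>(F :: nat set set) g h rk z (pos :: nat \<Rightarrow> 'a \<times> 'b).
    essential_labelling F g h (a + b) rk W z \<and> realization F g h pos (1 / real (a + b + 1)) \<delta>"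
proof -
  define n where "n = a + b"
  define \<kappa> where "\<kappa> = real n / real (n + 1)"
  define attainable where "attainable \<epsilon> \<longleftrightarrow> (\<exists>(F :: nat set set) g h rk z (pos :: nat \<Rightarrow> 'a \<times> 'b).
      essential_labelling F g h n rk W z \<and> realization F g h pos (1 / real (n + 1)) \<epsilon>)" for \<epsilon>
  obtain z and pos :: "_ \<Rightarrow> 'a \<times> 'b" and \<epsilon>\<^sub>0 where
    "essential_labelling (staircase a b) flip_left flip_right n staircase_rk W z"
    "realization (staircase a b) flip_left flip_right pos (1 / real (n + 1)) \<epsilon>\<^sub>0"
    using ex_essential_labelling_staircase[OF binomial ambient]
      ex_realization_staircase[OF binomial(1) dims]
    unfolding n_def[symmetric] by blast
  then have start: "attainable \<epsilon>\<^sub>0"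
    unfolding attainable_def by (rule essential_labelling.ex_nat_renaming)
  have step: "attainable (\<epsilon> * \<kappa>)" if "attainable \<epsilon>" for \<epsilon>
  proof -
    obtain F :: "nat set set" and g h rk z and pos :: "nat \<Rightarrow> 'a \<times> 'b" where
      "essential_labelling F g h n rk W z" and real: "realization F g h pos (1 / real (n + 1)) \<epsilon>"
      using \<open>attainable \<epsilon>\<close> unfolding attainable_def by blast
    then interpret essential_labelling F g h n rk W z by simp
    show ?thesis
      unfolding attainable_def
      by (rule essential_labelling.ex_nat_renaming[OF essential_labelling_subdivision
          realization_subdivision[OF real, folded \<kappa>_def]])
  qed
  have iterate: "attainable (\<epsilon>\<^sub>0 * \<kappa> ^ k)" for k
  proof (induction k)
    case (Suc k)
    then show ?case using step[of "\<epsilon>\<^sub>0 * \<kappa> ^ k"] by (simp add: mult_ac)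
  qed (simp add: start)
  have "(\<lambda>k. \<epsilon>\<^sub>0 * \<kappa> ^ k) \<longlonglongrightarrow> \<epsilon>\<^sub>0 * 0"
    by (intro tendsto_intros LIMSEQ_realpow_zero) (auto simp: \<kappa>_def)
  then have "\<forall>\<^sub>F k in sequentially. \<epsilon>\<^sub>0 * \<kappa> ^ k < \<delta>"
    using \<open>0 < \<delta>\<close> by (auto intro: order_tendstoD(2))
  then obtain k where "\<epsilon>\<^sub>0 * \<kappa> ^ k < \<delta>"
    by (meson eventually_happens' sequentially_bot)
  then show ?thesis
    using iterate[of k] realization_mono less_imp_le unfolding attainable_def n_def by blast
qed

lemma norm_sgn_diff_le:
  fixes x y :: "'p::real_normed_vector"
  assumes "x \<noteq> 0"
  shows "norm (sgn x - sgn y) \<le> 2 * norm (x - y) / norm x"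
proof (cases "y = 0")
  case False
  have "sgn x - sgn y = (1 / norm x) *\<^sub>R (x - y) + ((norm y - norm x) / (norm x * norm y)) *\<^sub>R y"
  proof -
    have "(norm y - norm x) / (norm x * norm y) = 1 / norm x - 1 / norm y"
      using assms False by (simp add: diff_divide_distrib)
    then show ?thesis
      by (simp add: sgn_div_norm scaleR_diff_left scaleR_diff_right inverse_eq_divide)
  qed
  also have "norm \<dots> \<le> norm ((1 / norm x) *\<^sub>R (x - y)) +
      norm (((norm y - norm x) / (norm x * norm y)) *\<^sub>R y)"
    by (rule norm_triangle_ineq)
  also have "\<dots> = (norm (x - y) + \<bar>norm y - norm x\<bar>) / norm x"
    using assms False by (simp add: add_divide_distrib abs_mult)
  also have "\<dots> \<le> (norm (x - y) + norm (x - y)) / norm x"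
    using norm_triangle_ineq3[of y x]
    by (intro divide_right_mono add_left_mono) (auto simp: norm_minus_commute)
  finally show ?thesis by simp
qed (use assms in \<open>simp add: norm_sgn\<close>)

definition sphere_point :: "'a::real_normed_vector \<times> 'b::real_normed_vector \<Rightarrow> 'a \<times> 'b" where
  "sphere_point p = (sgn (fst p), sgn (snd p))"

lemma sphere_point_g1: "sphere_point (g1 p) = g1 (sphere_point p)"
  and sphere_point_g2: "sphere_point (g2 p) = g2 (sphere_point p)"
  by (simp_all add: sphere_point_def g1_def g2_def sgn_minus)

lemma sphere_point_in_sphere_prod: "fst p \<noteq> 0 \<Longrightarrow> snd p \<noteq> 0 \<Longrightarrow> sphere_point p \<in> sphere_prod"
  by (simp add: sphere_point_def sphere_prod_def norm_sgn)

lemma dist_sphere_point_le: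
  assumes "0 < r" "r \<le> norm (fst p)" "r \<le> norm (snd p)"
  shows "dist (sphere_point p) (sphere_point q) \<le> 4 * dist p q / r"
proof -
  have dist_sgn_le: "dist (sgn x) (sgn y) \<le> 2 * dist p q / r"
    if "r \<le> norm x" "dist x y \<le> dist p q" for x y :: "'p::real_normed_vector"
  proof -
    have "x \<noteq> 0" using that(1) \<open>0 < r\<close> by auto
    then have "dist (sgn x) (sgn y) \<le> 2 * dist x y / norm x"
      using norm_sgn_diff_le[of x y] by (simp add: dist_norm)
    also have "\<dots> \<le> 2 * dist p q / r" using that \<open>0 < r\<close> by (intro frac_le) auto
    finally show ?thesis .
  qed
  have "dist (sphere_point p) (sphere_point q) \<le>
      dist (sgn (fst p)) (sgn (fst q)) + dist (sgn (snd p)) (sgn (snd q))"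
    unfolding sphere_point_def dist_Pair_Pair by (rule sqrt_sum_squares_le_sum) auto
  also have "\<dots> \<le> 2 * dist p q / r + 2 * dist p q / r"
    using assms by (intro add_mono dist_sgn_le dist_fst_le dist_snd_le)
  finally show ?thesis by simp
qed

lemma realization_norm_ge:
  assumes "realization F g h pos r \<delta>" "s \<in> F" "v \<in> s"
  shows "r \<le> norm (fst (pos v))" "r \<le> norm (snd (pos v))"
  using realizationD(3,4)[OF assms(1,2) hull_inc[OF imageI[OF assms(3)]]] .

lemma sphere_point_realization_in_sphere_prod:
  assumes "realization F g h pos r \<delta>" "0 < r" "v \<in> \<Union>F"
  shows "sphere_point (pos v) \<in> sphere_prod"
  using assms realization_norm_ge[OF assms(1)] by (intro sphere_point_in_sphere_prod) force+

lemma dist_sphere_point_realization_le: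
  assumes real: "realization F g h pos r \<delta>" and "0 < r" "s \<in> F" "u \<in> s" "v \<in> s"
  shows "dist (sphere_point (pos u)) (sphere_point (pos v)) \<le> 4 * \<delta> / r"
proof -
  have "dist (sphere_point (pos u)) (sphere_point (pos v)) \<le> 4 * dist (pos u) (pos v) / r"
    using assms realization_norm_ge[OF real] by (intro dist_sphere_point_le)
  also have "\<dots> \<le> 4 * \<delta> / r"
    using realizationD(5)[OF real assms(3-5)] \<open>0 < r\<close> by (simp add: divide_right_mono)
  finally show ?thesis .
qed

section \<open>Signed labels and the limit argument\<close>

definition signed_set :: "bool \<Rightarrow> ('a::real_vector \<times> 'b::real_vector) set \<Rightarrow> ('a \<times> 'b) set" where
  "signed_set \<sigma> X = (if \<sigma> then X \<union> (g1 \<circ> g2) ` X else g1 ` X \<union> g2 ` X)"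

lemma g1_g1: "g1 (g1 p) = p" and g2_g2: "g2 (g2 p) = p" and g2_g1: "g2 (g1 p) = g1 (g2 p)"
  by (simp_all add: g1_def g2_def)

lemma g1_signed_set: "p \<in> signed_set \<sigma> X \<Longrightarrow> g1 p \<in> signed_set (\<not> \<sigma>) X"
  and g2_signed_set: "p \<in> signed_set \<sigma> X \<Longrightarrow> g2 p \<in> signed_set (\<not> \<sigma>) X"
  by (auto simp: signed_set_def g1_g1 g2_g2 g2_g1 split: if_splits)

lemma G_orbit_eq_signed_sets: "G_orbit X = (\<Union>\<sigma>. signed_set \<sigma> X)"
  by (auto simp: G_orbit_def signed_set_def UNIV_bool)

lemma signed_set_FalseD: "p \<in> signed_set False X \<Longrightarrow> \<exists>a\<in>{g1, g2}. p \<in> a ` X"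
  and signed_set_TrueD: "p \<in> signed_set True X \<Longrightarrow> \<exists>b\<in>{id, g1 \<circ> g2}. p \<in> b ` X"
  by (simp_all add: signed_set_def)

lemma signed_sets_disjoint:
  assumes "X \<inter> g1 ` Y = {}" "X \<inter> g2 ` Y = {}" "Y \<inter> g1 ` X = {}" "Y \<inter> g2 ` X = {}"
  shows "signed_set True X \<inter> signed_set False Y = {}"
proof -
  have "x \<noteq> g1 y \<and> x \<noteq> g2 y \<and> g1 (g2 x) \<noteq> g1 y \<and> g1 (g2 x) \<noteq> g2 y" if "x \<in> X" "y \<in> Y" for x y
  proof -
    have "x \<noteq> g1 y" "x \<noteq> g2 y" "y \<noteq> g1 x" "y \<noteq> g2 x" using assms that by blast+
    then show ?thesis by (metis g1_g1 g2_g1 g2_g2)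
  qed
  then show ?thesis unfolding signed_set_def by fastforce
qed

lemma compact_signed_set:
  fixes X :: "('a::euclidean_space \<times> 'b::euclidean_space) set"
  assumes "compact X"
  shows "compact (signed_set \<sigma> X)"
proof -
  have "continuous_on S (g1 :: 'a \<times> 'b \<Rightarrow> _)" "continuous_on S (g2 :: 'a \<times> 'b \<Rightarrow> _)" for S
    by (intro linear_continuous_on linear_conv_bounded_linear[THEN iffD1] linear_g1 linear_g2)+
  moreover from this have "continuous_on S (g1 \<circ> g2 :: 'a \<times> 'b \<Rightarrow> _)" for S
    by (intro continuous_on_compose)
  ultimately show ?thesis
    using assms by (simp add: signed_set_def compact_Un compact_continuous_image)
qed

definition signed_point :: "('i \<Rightarrow> 'c::real_vector) \<Rightarrow> 'i \<times> bool \<Rightarrow> 'c \<times> real" where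
  "signed_point x l = (if snd l then (x (fst l), 1) else - (x (fst l), 1))"

lemma signed_point_flip: "signed_point x (apsnd Not l) = - signed_point x l"
  by (simp add: signed_point_def)

lemma balanced_signed_points_imp_hulls_meet:
  fixes x :: "'i \<Rightarrow> 'c::euclidean_space"
  assumes bal: "balanced (signed_point x) L"
  shows "convex hull (x ` {i. (i, False) \<in> L}) \<inter> convex hull (x ` {i. (i, True) \<in> L}) \<noteq> {}"
proof -
  define S where "S = x ` {i. (i, False) \<in> L}"
  define T where "T = x ` {i. (i, True) \<in> L}"
  define N where "N = convex hull (uminus ` S \<times> {-1 :: real})"
  define P where "P = convex hull (T \<times> {1 :: real})"
  have "convex hull (uminus ` S) = uminus ` (convex hull S)"
    using convex_hull_scaling[of "-1" S] by simp
  then have N_eq: "N = uminus ` (convex hull S) \<times> {-1}" by (simp add: N_def convex_hull_Times)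
  have P_eq: "P = (convex hull T) \<times> {1}" by (simp add: P_def convex_hull_Times)
  have "signed_point x ` L = uminus ` S \<times> {-1} \<union> T \<times> {1}"
  proof (intro equalityI subsetI)
    fix w assume "w \<in> signed_point x ` L"
    then obtain i \<sigma> where "(i, \<sigma>) \<in> L" "w = signed_point x (i, \<sigma>)" by auto
    then show "w \<in> uminus ` S \<times> {-1} \<union> T \<times> {1}"
      by (cases \<sigma>) (auto simp: signed_point_def S_def T_def)
  qed (force simp: signed_point_def S_def T_def)
  moreover have "convex hull (uminus ` S \<times> {-1} \<union> T \<times> {1}) = convex hull (N \<union> P)"
    unfolding N_def P_def by (rule hull_Un) (simp add: convex_Inter)
  ultimately have zero: "0 \<in> convex hull (N \<union> P)" using bal by simp
  have "N \<noteq> {}" "P \<noteq> {}"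
    using zero by (auto simp: N_eq P_eq convex_hull_Times zero_prod_def hull_same)
  then obtain u v p q where "u + v = 1" "p \<in> N" "q \<in> P" "0 = u *\<^sub>R p + v *\<^sub>R q"
    using zero convex_hull_union_two[of N P] by (auto simp: N_def P_def convex_convex_hull)
  then obtain a b
    where "u = v" "u + v = 1" "a \<in> convex hull S" "b \<in> convex hull T" "0 = v *\<^sub>R b - u *\<^sub>R a"
    by (auto simp: N_eq P_eq zero_prod_def)
  then have "a = b" by (simp flip: scaleR_diff_right)
  then show ?thesis
    using \<open>a \<in> convex hull S\<close> \<open>b \<in> convex hull T\<close> unfolding S_def T_def by blast
qed

lemma (in essential_labelling) ex_balanced_simplex_of_labels:
  fixes \<psi> :: "'l \<Rightarrow> 'w" and flip :: "'l \<Rightarrow> 'l"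
  assumes ex: "\<And>v. v \<in> \<Union>F \<Longrightarrow> \<exists>l. P v l"
    and P_g: "\<And>v l. v \<in> \<Union>F \<Longrightarrow> P v l \<Longrightarrow> P (g v) (flip l)"
    and P_h: "\<And>v l. v \<in> \<Union>F \<Longrightarrow> P v l \<Longrightarrow> P (h v) (flip l)"
    and flip: "\<And>l. flip (flip l) = l" and \<psi>_flip: "\<And>l. \<psi> (flip l) = - \<psi> l"
    and \<psi>_in: "\<And>v l. v \<in> \<Union>F \<Longrightarrow> P v l \<Longrightarrow> \<psi> l \<in> W"
  shows "\<exists>L. \<exists>s\<in>F. (\<forall>v\<in>s. P v (L v)) \<and> balanced (\<lambda>v. \<psi> (L v)) s"
proof -
  have "\<exists>L. \<forall>v\<in>\<Union>F. P v (L v) \<and> L (g v) = flip (L v) \<and> L (h v) = flip (L v)"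
    by (rule ex_equivariant_choice) (fact ex P_g P_h flip)+
  then obtain L where labels: "\<And>v. v \<in> \<Union>F \<Longrightarrow> P v (L v)"
    "\<And>v. v \<in> \<Union>F \<Longrightarrow> L (g v) = flip (L v)" "\<And>v. v \<in> \<Union>F \<Longrightarrow> L (h v) = flip (L v)"
    by blast
  have "odd_labelling F g h (\<lambda>v. \<psi> (L v))"
    unfolding odd_labelling_def by (intro ballI conjI) (simp_all only: labels(2,3) \<psi>_flip)
  moreover have "(\<lambda>v. \<psi> (L v)) ` \<Union>F \<subseteq> W"
    by (rule image_subsetI) (rule \<psi>_in[OF _ labels(1)])
  ultimately have "\<exists>s\<in>F. balanced (\<lambda>v. \<psi> (L v)) s" by (rule ex_balanced_simplex)
  then obtain s where simplex: "s \<in> F" and "balanced (\<lambda>v. \<psi> (L v)) s" ..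
  moreover have "\<forall>v\<in>s. P v (L v)" using labels(1)[OF UnionI[OF simplex]] ..
  ultimately show ?thesis by blast
qed

locale covering_data =
  fixes a b :: nat and V :: "'c::euclidean_space set" and I :: "'i set" and x :: "'i \<Rightarrow> 'c"
    and J :: "'j set" and K :: "'i \<Rightarrow> 'j \<Rightarrow> ('a::euclidean_space \<times> 'b::euclidean_space) set"
  assumes dims: "a < DIM('a)" "b < DIM('b)"
    and odd_binomial: "odd ((a + b) choose a)"
    and V: "subspace V" "dim V + 1 = a + b" and x_in_V: "x ` I \<subseteq> V"
    and card_J: "card J = a + b + 1"
    and finite_I: "finite I"
    and compact_K: "\<And>i j. i \<in> I \<Longrightarrow> j \<in> J \<Longrightarrow> compact (K i j)"
    and cover: "\<And>j. j \<in> J \<Longrightarrow> sphere_prod \<subseteq> (\<Union>i\<in>I. G_orbit (K i j))"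
begin

lemma ex_balanced_simplex_of_signed_labels:
  fixes pos :: "nat \<Rightarrow> 'a \<times> 'b"
  assumes essential: "essential_labelling F g h n rk (V \<times> (UNIV :: real set)) z"
    and real: "realization F g h pos r \<delta>" and "0 < r" and colour: "bij_betw c {..n} J"
  shows "\<exists>L. \<exists>s\<in>F.
    (\<forall>v\<in>s. fst (L v) \<in> I \<and> sphere_point (pos v) \<in> signed_set (snd (L v)) (K (fst (L v)) (c (rk v)))) \<and>
    balanced (\<lambda>v. signed_point x (L v)) s"
proof -
  interpret essential_labelling F g h n rk "V \<times> (UNIV :: real set)" z by fact
  define P where "P v l \<longleftrightarrow> fst l \<in> I \<and>
    sphere_point (pos v) \<in> signed_set (snd l) (K (fst l) (c (rk v)))" for v l
  have "\<exists>L. \<exists>s\<in>F. (\<forall>v\<in>s. P v (L v)) \<and> balanced (\<lambda>v. signed_point x (L v)) s"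
  proof (rule ex_balanced_simplex_of_labels)
    fix v assume vertex: "v \<in> \<Union>F"
    then have "c (rk v) \<in> J" using colour rk_bij by (auto simp: bij_betw_def)
    then obtain i where "i \<in> I" "sphere_point (pos v) \<in> G_orbit (K i (c (rk v)))"
      using cover sphere_point_realization_in_sphere_prod[OF real \<open>0 < r\<close> vertex] by blast
    then show "\<exists>l. P v l" by (auto simp: P_def G_orbit_eq_signed_sets)
    show "P (g v) (apsnd Not l)" "P (h v) (apsnd Not l)" if "P v l" for l
      using that realizationD(1,2)[OF real vertex]
      by (simp_all add: P_def rk_g[OF vertex] rk_h[OF vertex] sphere_point_g1 sphere_point_g2
          g1_signed_set g2_signed_set)
    show "signed_point x l \<in> V \<times> UNIV" if "P v l" for l
      using that x_in_V subspace_neg[OF V(1)] by (auto simp: P_def signed_point_def)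
  next
    show "apsnd Not (apsnd Not l) = l" for l :: "'i \<times> bool" by (cases l) simp
  qed (rule signed_point_flip)
  then show ?thesis unfolding P_def .
qed

lemma ex_close_points:
  assumes "0 < \<delta>"
  shows "\<exists>L q. (\<forall>j\<in>J. fst (L j) \<in> I \<and> q j \<in> signed_set (snd (L j)) (K (fst (L j)) j)) \<and>
    (\<forall>j\<in>J. \<forall>k\<in>J. dist (q j) (q k) < \<delta>) \<and> balanced (\<lambda>j. signed_point x (L j)) J"
proof -
  define r where "r = 1 / real (a + b + 1)"
  define \<epsilon> where "\<epsilon> = r * \<delta> / 5"
  have "0 < r" by (simp add: r_def)
  then have mesh: "0 < \<epsilon>" "4 * \<epsilon> / r < \<delta>" using \<open>0 < \<delta>\<close> by (simp_all add: \<epsilon>_def)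
  have "0 < a + b" using V(2) by linarith
  moreover have "subspace (V \<times> (UNIV :: real set))" "dim (V \<times> (UNIV :: real set)) = a + b"
    using V by (simp_all add: subspace_Times dim_Times)
  ultimately obtain F :: "nat set set" and g h rk z and pos :: "nat \<Rightarrow> 'a \<times> 'b" where
    essential: "essential_labelling F g h (a + b) rk (V \<times> (UNIV :: real set)) z"
    and real: "realization F g h pos r \<epsilon>"
    using ex_fine_essential_labelling[OF _ odd_binomial _ _ dims mesh(1)] unfolding r_def by blast
  interpret essential_labelling F g h "a + b" rk "V \<times> (UNIV :: real set)" z by fact
  obtain c where colour: "bij_betw c {..a + b} J"
    using card_J finite_same_card_bij[of "{..a + b}" J] by (auto simp: card_ge_0_finite)
  obtain L s where simplex: "s \<in> F" and bal: "balanced (\<lambda>v. signed_point x (L v)) s"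
    and labels: "\<And>v. v \<in> s \<Longrightarrow>
      fst (L v) \<in> I \<and> sphere_point (pos v) \<in> signed_set (snd (L v)) (K (fst (L v)) (c (rk v)))"
    using ex_balanced_simplex_of_signed_labels[OF essential real \<open>0 < r\<close> colour] by blast
  have bij: "bij_betw (c \<circ> rk) s J" by (rule bij_betw_trans[OF rk_bij[OF simplex] colour])
  define p where "p = inv_into s (c \<circ> rk)"
  have colour_p: "c (rk (p j)) = j" if "j \<in> J" for j
    using bij_betw_inv_into_right[OF bij that] by (simp add: p_def)
  have p_image: "p ` J = s"
    unfolding p_def by (rule bij_betw_imp_surj_on[OF bij_betw_inv_into[OF bij]])
  show ?thesis
  proof (intro exI conjI ballI)
    fix j assume "j \<in> J"
    then show "fst (L (p j)) \<in> I"
      "sphere_point (pos (p j)) \<in> signed_set (snd (L (p j))) (K (fst (L (p j))) j)"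
      using labels[of "p j"] colour_p p_image by auto
    fix k assume "k \<in> J"
    have "dist (sphere_point (pos (p j))) (sphere_point (pos (p k))) \<le> 4 * \<epsilon> / r"
      using p_image \<open>j \<in> J\<close> \<open>k \<in> J\<close>
      by (intro dist_sphere_point_realization_le[OF real \<open>0 < r\<close> simplex]) auto
    then show "dist (sphere_point (pos (p j))) (sphere_point (pos (p k))) < \<delta>" using mesh(2) by simp
  next
    show "balanced (\<lambda>j. signed_point x (L (p j))) J"
      using bal by (simp flip: p_image add: image_image)
  qed
qed

end

lemma compact_sets_eventually_apart:
  fixes K :: "'j \<Rightarrow> 'p::metric_space set"
  assumes compact: "\<And>j. j \<in> J \<Longrightarrow> compact (K j)" and "k \<in> J" and empty: "(\<Inter>j\<in>J. K j) = {}"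
  shows "\<forall>\<^sub>F \<delta> in at_right 0. \<nexists>q. \<forall>i\<in>J. q i \<in> K i \<and> (\<forall>j\<in>J. dist (q i) (q j) < \<delta>)"
proof -
  have complements_cover: "K k \<subseteq> \<Union>((\<lambda>j. - K j) ` J)" using empty by blast
  have open_complements: "open U" if "U \<in> (\<lambda>j. - K j) ` J" for U
    using that compact by (auto intro: open_Compl compact_imp_closed)
  obtain \<epsilon> where lebesgue_number: "0 < \<epsilon>" "\<And>p. p \<in> K k \<Longrightarrow> \<exists>U\<in>(\<lambda>j. - K j) ` J. ball p \<epsilon> \<subseteq> U"
    using Heine_Borel_lemma[OF compact[OF \<open>k \<in> J\<close>] complements_cover open_complements] by blast
  have "\<nexists>q. \<forall>i\<in>J. q i \<in> K i \<and> (\<forall>j\<in>J. dist (q i) (q j) < \<delta>)" if "\<delta> < \<epsilon>" for \<delta>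
  proof
    assume "\<exists>q. \<forall>i\<in>J. q i \<in> K i \<and> (\<forall>j\<in>J. dist (q i) (q j) < \<delta>)"
    then obtain q where close: "\<And>i. i \<in> J \<Longrightarrow> q i \<in> K i" "\<And>j. j \<in> J \<Longrightarrow> dist (q k) (q j) < \<delta>"
      using \<open>k \<in> J\<close> by blast
    obtain j where "j \<in> J" "ball (q k) \<epsilon> \<subseteq> - K j"
      using lebesgue_number(2)[OF close(1)[OF \<open>k \<in> J\<close>]] by blast
    moreover have "q j \<in> ball (q k) \<epsilon>" using close(2)[OF \<open>j \<in> J\<close>] \<open>\<delta> < \<epsilon>\<close> by simp
    ultimately show False using close(1) by blast
  qed
  then show ?thesis using lebesgue_number(1) by (auto intro!: eventually_at_rightI[of 0 \<epsilon>])
qed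

lemma ex_common_point_if_arbitrarily_close:
  fixes M :: "'l \<Rightarrow> 'j \<Rightarrow> 'p::metric_space set"
  assumes "finite \<Lambda>" "J \<noteq> {}" and compact: "\<And>L j. L \<in> \<Lambda> \<Longrightarrow> j \<in> J \<Longrightarrow> compact (M L j)"
    and close: "\<And>\<delta>. 0 < \<delta> \<Longrightarrow> \<exists>L\<in>\<Lambda>. \<exists>q. \<forall>i\<in>J. q i \<in> M L i \<and> (\<forall>j\<in>J. dist (q i) (q j) < \<delta>)"
  shows "\<exists>L\<in>\<Lambda>. (\<Inter>j\<in>J. M L j) \<noteq> {}"
proof (rule ccontr)
  let ?apart = "\<lambda>L \<delta>. \<nexists>q. \<forall>i\<in>J. q i \<in> M L i \<and> (\<forall>j\<in>J. dist (q i) (q j) < \<delta>)"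
  assume "\<not> (\<exists>L\<in>\<Lambda>. (\<Inter>j\<in>J. M L j) \<noteq> {})"
  then have "(\<Inter>j\<in>J. M L j) = {}" if "L \<in> \<Lambda>" for L using that by blast
  moreover obtain k where "k \<in> J" using \<open>J \<noteq> {}\<close> by blast
  ultimately have "\<forall>\<^sub>F \<delta> in at_right 0. ?apart L \<delta>" if "L \<in> \<Lambda>" for L
    using that by (intro compact_sets_eventually_apart compact)
  then have "\<forall>\<^sub>F \<delta> in at_right 0. \<forall>L\<in>\<Lambda>. ?apart L \<delta>"
    using \<open>finite \<Lambda>\<close> by (simp add: eventually_ball_finite)
  from eventually_happens'[OF trivial_limit_at_right_real
      eventually_conj[OF eventually_at_right_less this]]
  obtain \<delta> where "0 < \<delta>" "\<forall>L\<in>\<Lambda>. ?apart L \<delta>" by (elim exE conjE)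
  then show False using close[of \<delta>] by blast
qed

context covering_data
begin

lemma ex_common_point:
  obtains L p where "\<And>j. j \<in> J \<Longrightarrow> fst (L j) \<in> I"
    "\<And>j. j \<in> J \<Longrightarrow> p \<in> signed_set (snd (L j)) (K (fst (L j)) j)"
    "balanced (\<lambda>j. signed_point x (L j)) J"
proof -
  define \<Lambda> where "\<Lambda> = {L \<in> J \<rightarrow>\<^sub>E I \<times> UNIV. balanced (\<lambda>j. signed_point x (L j)) J}"
  define M where "M L j = signed_set (snd (L j)) (K (fst (L j)) j)" for L j
  have colours: "finite J" "J \<noteq> {}" using card_J card_ge_0_finite[of J] by auto
  have "\<exists>L\<in>\<Lambda>. (\<Inter>j\<in>J. M L j) \<noteq> {}"
  proof (rule ex_common_point_if_arbitrarily_close)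
    show "finite \<Lambda>" unfolding \<Lambda>_def using colours(1) finite_I by (simp add: finite_PiE)
    show "compact (M L j)" if "L \<in> \<Lambda>" "j \<in> J" for L j
      using that unfolding M_def \<Lambda>_def
      by (intro compact_signed_set compact_K) (auto simp: PiE_iff mem_Times_iff)
    fix \<delta> :: real assume "0 < \<delta>"
    then obtain L q where labels: "\<forall>j\<in>J. fst (L j) \<in> I \<and> q j \<in> M L j"
      "\<forall>i\<in>J. \<forall>j\<in>J. dist (q i) (q j) < \<delta>" "balanced (\<lambda>j. signed_point x (L j)) J"
      using ex_close_points unfolding M_def by blast
    then have "restrict L J \<in> \<Lambda>" by (auto simp: \<Lambda>_def mem_Times_iff)
    then show "\<exists>L\<in>\<Lambda>. \<exists>q. \<forall>i\<in>J. q i \<in> M L i \<and> (\<forall>j\<in>J. dist (q i) (q j) < \<delta>)"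
      using labels(1,2) by (intro bexI[of _ "restrict L J"] exI[of _ q]) (auto simp: M_def)
  qed (fact colours(2))
  then obtain L p where "L \<in> \<Lambda>" "p \<in> (\<Inter>j\<in>J. M L j)" by blast
  then show thesis
    by (intro that[of L p]) (auto simp: \<Lambda>_def M_def PiE_iff mem_Times_iff)
qed

end

lemma ex_colour_of_index:
  assumes "\<And>j k. j \<in> J \<Longrightarrow> k \<in> J \<Longrightarrow> fst (L j) = fst (L k) \<Longrightarrow> snd (L j) = snd (L k)"
  defines "S \<equiv> {i. (i, False) \<in> L ` J}" and "T \<equiv> {i. (i, True) \<in> L ` J}"
  obtains \<pi> where "S \<inter> T = {}" "\<pi> \<in> S \<union> T \<rightarrow> J" "inj_on \<pi> (S \<union> T)"
    "\<And>i. i \<in> S \<Longrightarrow> L (\<pi> i) = (i, False)" "\<And>i. i \<in> T \<Longrightarrow> L (\<pi> i) = (i, True)"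
proof -
  have agree: "\<sigma> = \<tau>" if "(i, \<sigma>) \<in> L ` J" "(i, \<tau>) \<in> L ` J" for i \<sigma> \<tau>
    using that assms(1) by (metis fst_conv imageE snd_conv)
  have "\<exists>j\<in>J. fst (L j) = i" if index: "i \<in> S \<union> T" for i
  proof -
    obtain \<sigma> where "(i, \<sigma>) \<in> L ` J" using index unfolding S_def T_def by blast
    then show ?thesis by (metis fst_conv imageE)
  qed
  then obtain \<pi> where colour_of: "\<And>i. i \<in> S \<union> T \<Longrightarrow> \<pi> i \<in> J \<and> fst (L (\<pi> i)) = i" by metis
  have label_of_colour: "L (\<pi> i) = (i, \<sigma>)" if "i \<in> S \<union> T" "(i, \<sigma>) \<in> L ` J" for i \<sigma>
  proof -
    have "(i, snd (L (\<pi> i))) \<in> L ` J" using colour_of[OF that(1)] by (metis imageI prod.collapse)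
    then have "snd (L (\<pi> i)) = \<sigma>" using agree that(2) by blast
    then show ?thesis using colour_of[OF that(1)] by (simp add: prod_eq_iff)
  qed
  show thesis
  proof
    show "S \<inter> T = {}" using agree unfolding S_def T_def by blast
    show "inj_on \<pi> (S \<union> T)" using colour_of by (metis inj_onI)
    show "L (\<pi> i) = (i, False)" if "i \<in> S" for i
      using label_of_colour[of i] that unfolding S_def by blast
    show "L (\<pi> i) = (i, True)" if "i \<in> T" for i
      using label_of_colour[of i] that unfolding T_def by blast
  qed (use colour_of in blast)
qed

theorem (in covering_data) colourful_Radon_partition:
  assumes disjoint: "\<And>i j k. i \<in> I \<Longrightarrow> j \<in> J \<Longrightarrow> k \<in> J \<Longrightarrow> j \<noteq> k \<Longrightarrow>
    K i j \<inter> g1 ` K i k = {} \<and> K i j \<inter> g2 ` K i k = {}"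
  shows "\<exists>S T \<alpha> \<beta> \<pi>.
    S \<subseteq> I \<and> T \<subseteq> I \<and> S \<inter> T = {} \<and>
    \<alpha> \<in> S \<rightarrow> {g1, g2} \<and> \<beta> \<in> T \<rightarrow> {id, g1 \<circ> g2} \<and>
    \<pi> \<in> S \<union> T \<rightarrow> J \<and> inj_on \<pi> (S \<union> T) \<and>
    convex hull (x ` S) \<inter> convex hull (x ` T) \<noteq> {} \<and>
    (\<Inter>i\<in>S. \<alpha> i ` K i (\<pi> i)) \<inter> (\<Inter>i\<in>T. \<beta> i ` K i (\<pi> i)) \<noteq> {}"
proof -
  obtain L p where index: "\<And>j. j \<in> J \<Longrightarrow> fst (L j) \<in> I"
    and common: "\<And>j. j \<in> J \<Longrightarrow> p \<in> signed_set (snd (L j)) (K (fst (L j)) j)"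
    and bal: "balanced (\<lambda>j. signed_point x (L j)) J"
    using ex_common_point by blast
  define S where "S = {i. (i, False) \<in> L ` J}"
  define T where "T = {i. (i, True) \<in> L ` J}"
  have not_both: "\<not> (snd (L j) \<and> \<not> snd (L k))"
    if same_index: "j \<in> J" "k \<in> J" "fst (L j) = fst (L k)" for j k
  proof
    assume signs: "snd (L j) \<and> \<not> snd (L k)"
    then have "j \<noteq> k" by blast
    then have "signed_set True (K (fst (L j)) j) \<inter> signed_set False (K (fst (L j)) k) = {}"
      using disjoint[OF index[OF same_index(1)] same_index(1,2)]
        disjoint[OF index[OF same_index(1)] same_index(2,1)]
      by (intro signed_sets_disjoint) auto
    then show False
      using common[OF same_index(1)] common[OF same_index(2)] same_index(3) signs by auto
  qed
  have "snd (L j) = snd (L k)" if "j \<in> J" "k \<in> J" "fst (L j) = fst (L k)" for j k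
    using not_both[OF that] not_both[OF that(2,1)] that(3) by auto
  then obtain \<pi> where colour: "S \<inter> T = {}" "\<pi> \<in> S \<union> T \<rightarrow> J" "inj_on \<pi> (S \<union> T)"
    and colour_S: "\<And>i. i \<in> S \<Longrightarrow> L (\<pi> i) = (i, False)" and colour_T: "\<And>i. i \<in> T \<Longrightarrow> L (\<pi> i) = (i, True)"
    using ex_colour_of_index[of J L] unfolding S_def T_def by blast
  have "\<exists>a\<in>{g1, g2}. p \<in> a ` K i (\<pi> i)" if "i \<in> S" for i
    using common[of "\<pi> i"] colour(2) colour_S[OF that] that by (intro signed_set_FalseD) auto
  then obtain \<alpha> where choice_S: "\<And>i. i \<in> S \<Longrightarrow> \<alpha> i \<in> {g1, g2} \<and> p \<in> \<alpha> i ` K i (\<pi> i)" by metis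
  have "\<exists>b\<in>{id, g1 \<circ> g2}. p \<in> b ` K i (\<pi> i)" if "i \<in> T" for i
    using common[of "\<pi> i"] colour(2) colour_T[OF that] that by (intro signed_set_TrueD) auto
  then obtain \<beta> where choice_T: "\<And>i. i \<in> T \<Longrightarrow> \<beta> i \<in> {id, g1 \<circ> g2} \<and> p \<in> \<beta> i ` K i (\<pi> i)" by metis
  show ?thesis
  proof (rule exI[of _ S], rule exI[of _ T], rule exI[of _ \<alpha>], rule exI[of _ \<beta>], rule exI[of _ \<pi>],
      intro conjI)
    have "i \<in> I" if "(i, \<sigma>) \<in> L ` J" for i \<sigma> using that index by (metis fst_conv imageE)
    then show "S \<subseteq> I" "T \<subseteq> I" unfolding S_def T_def by blast+
    show "convex hull (x ` S) \<inter> convex hull (x ` T) \<noteq> {}"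
      using balanced_signed_points_imp_hulls_meet[of x "L ` J"] bal
      by (simp add: image_image S_def T_def)
    have "p \<in> (\<Inter>i\<in>S. \<alpha> i ` K i (\<pi> i)) \<inter> (\<Inter>i\<in>T. \<beta> i ` K i (\<pi> i))" using choice_S choice_T by blast
    then show "(\<Inter>i\<in>S. \<alpha> i ` K i (\<pi> i)) \<inter> (\<Inter>i\<in>T. \<beta> i ` K i (\<pi> i)) \<noteq> {}" by blast
  qed (use colour choice_S choice_T in auto)
qed

theorem theorem6p4:
  fixes t d m :: nat
    and V :: "'c::euclidean_space set"
    and x :: "nat \<Rightarrow> 'c"
    and A :: "nat \<Rightarrow> nat \<Rightarrow> ('a::euclidean_space \<times> 'b::euclidean_space) set"
  assumes "d = 2 ^ t"
    and "DIM('a) = d + 1" and "DIM('b) = d"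
    and "subspace V" and "dim V = 2 * d - 2"
    and "m > 0"
    and "x ` {1..m} \<subseteq> V" and "inj_on x {1..m}"
    and "\<And>i j. i \<in> {1..m} \<Longrightarrow> j \<in> {1..2*d} \<Longrightarrow>
           closedin (top_of_set sphere_prod) (A i j)"
    and "\<And>i j k. i \<in> {1..m} \<Longrightarrow> j \<in> {1..2*d} \<Longrightarrow> k \<in> {1..2*d} \<Longrightarrow> j \<noteq> k \<Longrightarrow>
           A i j \<inter> g1 ` A i k = {} \<and> A i j \<inter> g2 ` A i k = {}"
    and "\<And>j. j \<in> {1..2*d} \<Longrightarrow> (\<Union>i\<in>{1..m}. G_orbit (A i j)) = sphere_prod"
  shows "\<exists>S T \<alpha> \<beta> \<pi>.
           S \<subseteq> {1..m} \<and> T \<subseteq> {1..m} \<and> S \<inter> T = {} \<and>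
           \<alpha> \<in> S \<rightarrow> {g1, g2} \<and> \<beta> \<in> T \<rightarrow> {id, g1 \<circ> g2} \<and>
           \<pi> \<in> S \<union> T \<rightarrow> {1..2*d} \<and> inj_on \<pi> (S \<union> T) \<and>
           convex hull (x ` S) \<inter> convex hull (x ` T) \<noteq> {} \<and>
           (\<Inter>i\<in>S. \<alpha> i ` A i (\<pi> i)) \<inter> (\<Inter>i\<in>T. \<beta> i ` A i (\<pi> i)) \<noteq> {}"
proof -
  have "0 < d" using assms(1) by simp
  interpret covering_data d "d - 1" V "{1..m}" x "{1..2*d}" A
  proof
    show "odd ((d + (d - 1)) choose d)"
      using odd_binomial_power_2_minus_1[of d "Suc t"] assms(1) by (simp add: mult_2)
    have "compact (sphere_prod :: ('a \<times> 'b) set)" by (simp add: sphere_prod_def compact_Times)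
    then show "compact (A i j)" if "i \<in> {1..m}" "j \<in> {1..2*d}" for i j
      using closedin_compact assms(9)[OF that] by blast
    show "dim V + 1 = d + (d - 1)" "card {1..2*d} = d + (d - 1) + 1"
      using assms(5) \<open>0 < d\<close> by simp_all
  qed (use assms \<open>0 < d\<close> in simp_all)
  show ?thesis by (rule colourful_Radon_partition) (rule assms(10))
qed

end
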